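(* Let $\mathbb F$ be a non-archimedean (NA) valued field with $\operatorname{char}(\mathbb F)=0$ and let $(X,\mathcal U)$ be a (nonempty) Hausdorff NA uniform space. Consider the uniform free NA abelian topological group $A_{\mathcal{NA}}(X,\mathcal U)$, whose underlying group is the free abelian group $A(X)$, as an algebraic subgroup of $L_{\mathbb F}(X)$ (the subgroup generated by $X$). The following conditions are equivalent: (1) $A_{\mathcal{NA}}(X,\mathcal U)$ is a topological subgroup of the free NA locally convex space $L_{\mathbb F}(X,\mathcal U)$. (2) The valuation of $\mathbb F$ is trivial on $\mathbb Q$.
   Context: A non-archimedean (NA) valued field is a field with a valuation $|\cdot|:\mathbb F\to[0,\infty)$ with $|x|=0\iff x=0$, $|xy|=|x||y|$, $|x+y|\le\max\{|x|,|y|\}$ (the trivial valuation is allowed). When $\operatorname{char}\mathbb F=0$, $\mathbb Q\subseteq\mathbb F$; "trivial on $\mathbb Q$" means $|q|=1$ for all $q\in\mathbb Q\setminus\{0\}$. A uniform space is NA if its uniformity has a base of equivalence relations. A topological group is NA if it has a base at the identity consisting of open subgroups. An ultra-seminorm on an $\mathbb F$-vector space is a map $p\ge0$ with $p(0)=0$, $p(x+y)\le\max\{p(x),p(y)\}$, $p(\alpha x)=|\alpha|p(x)$. An NA locally convex $\mathbb F$-space is a Hausdorff topological $\mathbb F$-vector space whose topology is generated by a family of ultra-seminorms; it carries its natural additive uniformity. $L_{\mathbb F}(X)$ is the free $\mathbb F$-vector space on $X$, with zero vector $\mathbf 0\notin X$, and $\overline X:=X\cup\{\mathbf 0\}\subseteq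 L_{\mathbb F}(X)$. The free NA locally convex space $L_{\mathbb F}(X,\mathcal U)$ is the NA locally convex $\mathbb F$-space with underlying vector space $L_{\mathbb F}(X)$ such that the canonical map $X\to L_{\mathbb F}(X)$ is uniformly continuous and every uniformly continuous map from $(X,\mathcal U)$ to an NA locally convex $\mathbb F$-space $V$ extends (uniquely) to a continuous linear map $L_{\mathbb F}(X,\mathcal U)\to V$. It exists; its topology is generated by the ultra-seminorms $\|u\|_d=\inf\{\max_i|s_i|d(a_i,b_i): u=\sum_{i=1}^k s_i(a_i-b_i),\ a_i,b_i\in\overline X,\ s_i\in\mathbb F\}$, where $d$ runs over the ultra-pseudometrics on $\overline X$ uniformly continuous for the uniformity obtained from $\mathcal U$ by adding $\mathbf 0$ as an isolated point. The uniform free NA abelian topological group $A_{\mathcal{NA}}(X,\mathcal U)$ is the NA abelian topological group with a uniformly continuous map $i:X\to A_{\mathcal{NA}}(X,\mathcal U)$ such that every uniformly continuous map $\varphi:(X,\mathcal U)\to G$ into an NA abelian topological group factors uniquely as $\varphi=\Phi\circ i$ with $\Phi$ a continuous homomorphism. Its underlying group is the free abelian group $A(X)$, and (known fact) for any base $\mathcal B$ of $\mathcal U$ consisting of equivalence relations, the subgroups $\langle\varepsilon\rangle$ generated by $\{x-y:(x,y)\in\varepsilon\}$, $\varepsilon\in\mathcal B$, form a local base at zero. *)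

theory Defs
  imports "HOL-Analysis.Analysis" "HOL-Library.Poly_Mapping"
begin

section \<open>Non-archimedean valued fields and uniform spaces\<close>

definition NA_valuation :: "('f::field \<Rightarrow> real) \<Rightarrow> bool" where
  "NA_valuation v \<longleftrightarrow>
     (\<forall>x. 0 \<le> v x) \<and> (\<forall>x. v x = 0 \<longleftrightarrow> x = 0) \<and>
     (\<forall>x y. v (x * y) = v x * v y) \<and> (\<forall>x y. v (x + y) \<le> max (v x) (v y))"

definition valuation_topology :: "('f::field \<Rightarrow> real) \<Rightarrow> 'f topology" where
  "valuation_topology v = Metric_space.mtopology UNIV (\<lambda>x y. v (x - y))"

definition trivial_on_rationals :: "('f::field_char_0 \<Rightarrow> real) \<Rightarrow> bool" where
  "trivial_on_rationals v \<longleftrightarrow> (\<forall>q::rat. q \<noteq> 0 \<longrightarrow> v (of_rat q) = 1)"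

definition NA_uniformity :: "('a \<times> 'a) filter \<Rightarrow> bool" where
  "NA_uniformity \<U> \<longleftrightarrow>
     (\<forall>E. eventually (\<lambda>z. z \<in> E) \<U> \<longrightarrow>
        (\<exists>R. equiv UNIV R \<and> eventually (\<lambda>z. z \<in> R) \<U> \<and> R \<subseteq> E))"


section \<open>Non-archimedean abelian topological groups\<close>

definition additive_subgroup :: "'g::ab_group_add set \<Rightarrow> bool" where
  "additive_subgroup H \<longleftrightarrow> 0 \<in> H \<and> (\<forall>x\<in>H. \<forall>y\<in>H. x + y \<in> H) \<and> (\<forall>x\<in>H. - x \<in> H)"

definition topological_abelian_group :: "'g::ab_group_add topology \<Rightarrow> bool" where
  "topological_abelian_group T \<longleftrightarrow>
     topspace T = UNIV \<and>
     continuous_map (prod_topology T T) T (\<lambda>(x, y). x + y) \<and> continuous_map T T uminus"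

definition NA_abelian_group :: "'g::ab_group_add topology \<Rightarrow> bool" where
  "NA_abelian_group T \<longleftrightarrow>
     topological_abelian_group T \<and>
     (\<forall>U. openin T U \<and> 0 \<in> U \<longrightarrow> (\<exists>H. openin T H \<and> additive_subgroup H \<and> H \<subseteq> U))"

definition additive_uniformity :: "'g::ab_group_add topology \<Rightarrow> ('g \<times> 'g) filter" where
  "additive_uniformity T = filtercomap (\<lambda>(x, y). x - y) (nhdsin T 0)"

definition uniformly_continuous_into ::
    "'g::ab_group_add topology \<Rightarrow> ('x::uniform_space \<Rightarrow> 'g) \<Rightarrow> bool" where
  "uniformly_continuous_into T \<phi> \<longleftrightarrow>
     filterlim (\<lambda>(x, y). (\<phi> x, \<phi> y)) (additive_uniformity T) uniformity"


section \<open>Non-archimedean locally convex spaces\<close>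

definition ultra_seminorm ::
    "('f::field \<Rightarrow> real) \<Rightarrow> ('f \<Rightarrow> 'v::ab_group_add \<Rightarrow> 'v) \<Rightarrow> ('v \<Rightarrow> real) \<Rightarrow> bool" where
  "ultra_seminorm v s p \<longleftrightarrow>
     (\<forall>x. 0 \<le> p x) \<and> p 0 = 0 \<and> (\<forall>x y. p (x + y) \<le> max (p x) (p y)) \<and>
     (\<forall>a x. p (s a x) = v a * p x)"

(* UNIV is added to the subbasis because topology_generated_by {} is the topology
   on the empty set, not the indiscrete one. *)
definition seminorm_topology :: "('v::ab_group_add \<Rightarrow> real) set \<Rightarrow> 'v topology" where
  "seminorm_topology P =
     topology_generated_by (insert UNIV {{y. p (y - x) < r} | p x r. p \<in> P \<and> 0 < r})"

definition NA_locally_convex ::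
    "('f::field \<Rightarrow> real) \<Rightarrow> ('f \<Rightarrow> 'v::ab_group_add \<Rightarrow> 'v) \<Rightarrow> 'v topology \<Rightarrow> bool" where
  "NA_locally_convex v s T \<longleftrightarrow>
     vector_space s \<and> topological_abelian_group T \<and>
     continuous_map (prod_topology (valuation_topology v) T) T (\<lambda>(a, x). s a x) \<and>
     Hausdorff_space T \<and>
     (\<exists>P. (\<forall>p\<in>P. ultra_seminorm v s p) \<and> T = seminorm_topology P)"


section \<open>The free objects\<close>

(* L(X) is the type of finitely supported functions from X to the field. *)
definition vec_of :: "'x \<Rightarrow> 'x \<Rightarrow>\<^sub>0 'f::field" where
  "vec_of x = Poly_Mapping.single x 1"

definition vec_scale :: "'f::field \<Rightarrow> ('x \<Rightarrow>\<^sub>0 'f) \<Rightarrow> 'x \<Rightarrow>\<^sub>0 'f" where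
  "vec_scale a u = Poly_Mapping.map (\<lambda>c. a * c) u"

(* The universal property with respect to test spaces whose underlying group is the type 'v. *)
definition free_NA_locally_convex_for ::
    "'v::ab_group_add itself \<Rightarrow> ('f::field \<Rightarrow> real) \<Rightarrow> ('x::uniform_space \<Rightarrow>\<^sub>0 'f) topology \<Rightarrow> bool" where
  "free_NA_locally_convex_for TYPE('v) v T \<longleftrightarrow>
     NA_locally_convex v vec_scale T \<and> uniformly_continuous_into T vec_of \<and>
     (\<forall>(s :: 'f \<Rightarrow> 'v \<Rightarrow> 'v) T' \<phi>.
        NA_locally_convex v s T' \<and> uniformly_continuous_into T' \<phi> \<longrightarrow>
        (\<exists>!\<Phi>. Vector_Spaces.linear vec_scale s \<Phi> \<and> continuous_map T T' \<Phi> \<and>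
               (\<forall>x. \<Phi> (vec_of x) = \<phi> x)))"

(* A definition cannot quantify over types, so the test type is L(X) itself. This is no
   restriction: by free_NA_locally_convex_universal below, the universal property then holds
   for every type of test spaces. *)
definition free_NA_locally_convex ::
    "('f::field \<Rightarrow> real) \<Rightarrow> ('x::uniform_space \<Rightarrow>\<^sub>0 'f) topology \<Rightarrow> bool" where
  "free_NA_locally_convex v T \<longleftrightarrow> free_NA_locally_convex_for TYPE('x \<Rightarrow>\<^sub>0 'f) v T"

(* The free abelian group A(X) is the library's type of finitely supported integer functions,
   with frag_of as canonical map. *)
definition free_NA_abelian_group_for ::
    "'g::ab_group_add itself \<Rightarrow> ('x::uniform_space \<Rightarrow>\<^sub>0 int) topology \<Rightarrow> bool" where
  "free_NA_abelian_group_for TYPE('g) T \<longleftrightarrow>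
     NA_abelian_group T \<and> uniformly_continuous_into T frag_of \<and>
     (\<forall>(T' :: 'g topology) \<phi>.
        NA_abelian_group T' \<and> uniformly_continuous_into T' \<phi> \<longrightarrow>
        (\<exists>!\<Phi>. Modules.additive \<Phi> \<and> continuous_map T T' \<Phi> \<and> (\<forall>x. \<Phi> (frag_of x) = \<phi> x)))"

(* Again no restriction, see free_NA_abelian_group_universal. *)
definition free_NA_abelian_group :: "('x::uniform_space \<Rightarrow>\<^sub>0 int) topology \<Rightarrow> bool" where
  "free_NA_abelian_group T \<longleftrightarrow> free_NA_abelian_group_for TYPE('x \<Rightarrow>\<^sub>0 int) T"

(* The homomorphism from A(X) to L(X) that is the identity on X; in characteristic 0 it
   identifies A(X) with the subgroup of L(X) generated by X. *)
definition A_into_L :: "('x \<Rightarrow>\<^sub>0 int) \<Rightarrow> 'x \<Rightarrow>\<^sub>0 'f::field_char_0" where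
  "A_into_L u = Poly_Mapping.map of_int u"

section \<open>The universal properties\<close>

text \<open>The free topologies exist, are unique, and have the universal property with respect to
  test objects of any type.\<close>

subsection \<open>Locally convex spaces\<close>

lemma ultra_seminormD:
  assumes "ultra_seminorm v s p"
  shows "0 \<le> p x" "p 0 = 0" "p (x + y) \<le> max (p x) (p y)" "p (s a x) = v a * p x"
  using assms by (auto simp: ultra_seminorm_def)

lemma NA_valuation_one:
  assumes "NA_valuation v" shows "v (1::'f::field) = 1" "v (-1::'f) = 1"
proof -
  have "v 1 * v 1 = v 1" "v 1 \<noteq> 0" "0 \<le> v (-1)" "v (-1) * v (-1) = v 1"
    using assms unfolding NA_valuation_def by (metis mult_1, simp, simp, metis mult_minus1 minus_minus)
  then show 1: "v 1 = 1" by simp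
  have "(v (-1))\<^sup>2 = 1" using \<open>v (-1) * v (-1) = v 1\<close> 1 by (simp add: power2_eq_square)
  with \<open>0 \<le> v (-1)\<close> show "v (-1) = 1" by (simp add: power2_eq_1_iff)
qed

lemma ultra_seminorm_uminus:
  assumes "NA_valuation v" "vector_space s" "ultra_seminorm v s p"
  shows "p (- x) = p x"
proof -
  interpret vector_space s by fact
  have "p (s (-1) x) = p x"
    using ultra_seminormD(4)[OF assms(3)] NA_valuation_one(2)[OF assms(1)] by (metis mult_1)
  moreover have "s (-1) x = - x" using scale_minus_left[of 1 x] by simp
  ultimately show ?thesis by simp
qed

lemma openin_seminorm_topology:
  assumes "\<And>p. p \<in> P \<Longrightarrow> ultra_seminorm v s p"
  shows "openin (seminorm_topology P) U \<longleftrightarrow>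
    (\<forall>x\<in>U. \<exists>F r. finite F \<and> F \<subseteq> P \<and> 0 < r \<and> {y. \<forall>p\<in>F. p (y - x) < r} \<subseteq> U)" (is "_ \<longleftrightarrow> ?R U")
proof
  assume "openin (seminorm_topology P) U"
  then have "generate_topology_on (insert UNIV {{y. p (y - x) < r} | p x r. p \<in> P \<and> 0 < r}) U"
    by (simp add: seminorm_topology_def openin_topology_generated_by_iff)
  then show "?R U"
  proof induction
    case (Int a b)
    show ?case
    proof
      fix x assume x: "x \<in> a \<inter> b"
      obtain F r where 1: "finite F" "F \<subseteq> P" "(0::real) < r" "{y. \<forall>p\<in>F. p (y - x) < r} \<subseteq> a"
        using bspec[OF Int.IH(1), of x] x by auto
      obtain G t where 2: "finite G" "G \<subseteq> P" "(0::real) < t" "{y. \<forall>p\<in>G. p (y - x) < t} \<subseteq> b"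
        using bspec[OF Int.IH(2), of x] x by auto
      have "finite (F \<union> G)" "F \<union> G \<subseteq> P" "0 < min r t" "{y. \<forall>p\<in>F \<union> G. p (y - x) < min r t} \<subseteq> a \<inter> b"
        using 1 2 by auto
      then show "\<exists>F r. finite F \<and> F \<subseteq> P \<and> 0 < r \<and> {y. \<forall>p\<in>F. p (y - x) < r} \<subseteq> a \<inter> b"
        by (intro exI conjI)
    qed
  next
    case (UN K)
    show ?case
    proof
      fix x assume "x \<in> \<Union>K"
      then obtain k where "k \<in> K" "x \<in> k" by blast
      then obtain F r where 1: "finite F" "F \<subseteq> P" "(0::real) < r" "{y. \<forall>p\<in>F. p (y - x) < r} \<subseteq> k"
        using bspec[OF UN.IH[of k], of x] by auto
      then show "\<exists>F r. finite F \<and> F \<subseteq> P \<and> 0 < r \<and> {y. \<forall>p\<in>F. p (y - x) < r} \<subseteq> \<Union>K"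
        using \<open>k \<in> K\<close> by (intro exI[of _ F] exI[of _ r]) auto
    qed
  next
    case (Basis a)
    show ?case
    proof
      fix x assume x: "x \<in> a"
      consider "a = UNIV" | p c r where "a = {y. p (y - c) < r}" "p \<in> P" "0 < r"
        using Basis by blast
      then show "\<exists>F r. finite F \<and> F \<subseteq> P \<and> 0 < r \<and> {y. \<forall>p\<in>F. p (y - x) < r} \<subseteq> a"
      proof cases
        case 1 then show ?thesis by (intro exI[of _ "{}"] exI[of _ 1]) auto
      next
        case 2
        have "p (y - c) < r" if "p (y - x) < r" for y
          using ultra_seminormD(3)[OF assms[OF 2(2)], of "y - x" "x - c"] that x 2 by simp
        then show ?thesis using 2 by (intro exI[of _ "{p}"] exI[of _ r]) auto
      qed
    qed
  qed simp
next
  assume R: "?R U"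
  have op: "openin (seminorm_topology P) {y. \<forall>p\<in>F. p (y - x) < r}"
    if "finite F" "F \<subseteq> P" "0 < r" for F x r
    using that
  proof (induction F)
    case empty
    then show ?case unfolding seminorm_topology_def by (intro topology_generated_by_Basis) simp
  next
    case (insert q F)
    have q: "q \<in> P" "0 < r" and "F \<subseteq> P" using insert.prems by auto
    have "openin (seminorm_topology P) {y. q (y - x) < r}"
      unfolding seminorm_topology_def using q by (intro topology_generated_by_Basis) blast
    moreover have "openin (seminorm_topology P) {y. \<forall>p\<in>F. p (y - x) < r}"
      using insert.IH \<open>F \<subseteq> P\<close> q(2) by simp
    moreover have "{y. \<forall>p\<in>insert q F. p (y - x) < r} = {y. q (y - x) < r} \<inter> {y. \<forall>p\<in>F. p (y - x) < r}"
      by auto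
    ultimately show ?case by (simp only: openin_Int)
  qed
  show "openin (seminorm_topology P) U"
  proof (subst openin_subopen, intro ballI)
    fix x assume "x \<in> U"
    from bspec[OF R this]
    obtain F r where F: "finite F" "F \<subseteq> P" "(0::real) < r" "{y. \<forall>p\<in>F. p (y - x) < r} \<subseteq> U"
      by (elim exE conjE)
    moreover have "p (x - x) < r" if "p \<in> F" for p
      using F(2,3) that ultra_seminormD(2)[OF assms[of p]] by auto
    then have "x \<in> {y. \<forall>p\<in>F. p (y - x) < r}" by blast
    ultimately show "\<exists>T. openin (seminorm_topology P) T \<and> x \<in> T \<and> T \<subseteq> U"
      using op[OF F(1-3), of x] F(4) by (intro exI conjI)
  qed
qed

lemma topspace_seminorm_topology [simp]: "topspace (seminorm_topology P) = UNIV"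
  by (auto simp: seminorm_topology_def)

lemma openin_seminorm_ball:
  "p \<in> P \<Longrightarrow> 0 < r \<Longrightarrow> openin (seminorm_topology P) {y. p (y - x) < r}"
  unfolding seminorm_topology_def by (intro topology_generated_by_Basis) blast

lemma continuous_map_seminorm_topology:
  "continuous_map T (seminorm_topology P) f \<longleftrightarrow>
     (\<forall>p\<in>P. \<forall>c. \<forall>r>0. openin T {x \<in> topspace T. p (f x - c) < r})"
proof -
  let ?S = "insert UNIV {{y. p (y - x) < r} | p x r. p \<in> P \<and> 0 < r}"
  have eq: "f -` {y. p (y - c) < r} \<inter> topspace T = {x \<in> topspace T. p (f x - c) < r}" for p c and r :: real
    by auto
  have "(\<forall>U. U \<in> ?S \<longrightarrow> openin T (f -` U \<inter> topspace T)) \<longleftrightarrow>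
      (\<forall>p\<in>P. \<forall>c. \<forall>r>0. openin T (f -` {y. p (y - c) < r} \<inter> topspace T))" (is "?l = ?r")
  proof
    assume l: ?l
    show ?r
    proof (intro ballI allI impI)
      fix p c and r :: real assume "p \<in> P" "0 < r"
      then have "{y. p (y - c) < r} \<in> ?S" by blast
      then show "openin T (f -` {y. p (y - c) < r} \<inter> topspace T)" using l by blast
    qed
  next
    assume r: ?r
    show ?l
    proof (intro allI impI)
      fix U assume "U \<in> ?S"
      then consider "U = UNIV" | p c r where "U = {y. p (y - c) < r}" "p \<in> P" "(0::real) < r"
        by blast
      then show "openin T (f -` U \<inter> topspace T)"
        by cases (use r in simp_all)
    qed
  qed
  then show ?thesis
    unfolding seminorm_topology_def continuous_on_generated_topo_iff eq by simp
qed

lemma uniformly_continuous_into_iff: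
  assumes "0 \<in> topspace T"
  shows "uniformly_continuous_into T \<phi> \<longleftrightarrow>
    (\<forall>U. openin T U \<and> 0 \<in> U \<longrightarrow> eventually (\<lambda>(x, y). \<phi> x - \<phi> y \<in> U) uniformity)"
proof -
  have "uniformly_continuous_into T \<phi> \<longleftrightarrow>
      filterlim ((\<lambda>(x, y). x - y) \<circ> (\<lambda>(x, y). (\<phi> x, \<phi> y))) (nhdsin T 0) uniformity"
    by (simp add: uniformly_continuous_into_def additive_uniformity_def filterlim_filtercomap_iff)
  also have "((\<lambda>(x, y). x - y) \<circ> (\<lambda>(x, y). (\<phi> x, \<phi> y))) = (\<lambda>(x, y). \<phi> x - \<phi> y)"
    by auto
  also have "filterlim (\<lambda>(x, y). \<phi> x - \<phi> y) (nhdsin T 0) uniformity \<longleftrightarrow>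
      (\<forall>U. openin T U \<and> 0 \<in> U \<longrightarrow> eventually (\<lambda>(x, y). \<phi> x - \<phi> y \<in> U) uniformity)" (is "?l = ?r")
  proof
    assume L: ?l
    show ?r
    proof (intro allI impI)
      fix U assume "openin T U \<and> 0 \<in> U"
      then have "eventually (\<lambda>x. x \<in> U) (nhdsin T 0)" by (auto simp: eventually_nhdsin)
      then have "eventually (\<lambda>z. (case z of (x, y) \<Rightarrow> \<phi> x - \<phi> y) \<in> U) uniformity"
        using L unfolding filterlim_iff by blast
      then show "eventually (\<lambda>(x, y). \<phi> x - \<phi> y \<in> U) uniformity"
        by (simp add: case_prod_unfold)
    qed
  next
    assume R: ?r
    show ?l unfolding filterlim_iff
    proof (intro allI impI)
      fix Q assume "eventually Q (nhdsin T 0)"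
      then obtain S where S: "openin T S" "0 \<in> S" "\<forall>x\<in>S. Q x" using assms by (auto simp: eventually_nhdsin)
      then have "eventually (\<lambda>(x, y). \<phi> x - \<phi> y \<in> S) uniformity" using R by blast
      then show "eventually (\<lambda>x. Q (case x of (x, y) \<Rightarrow> \<phi> x - \<phi> y)) uniformity"
        by (rule eventually_mono) (use S in auto)
    qed
  qed
  finally show ?thesis .
qed

lemma uniformly_continuous_into_seminorm_topology:
  assumes P: "\<forall>p\<in>P. ultra_seminorm v s p"
  shows "uniformly_continuous_into (seminorm_topology P) \<phi> \<longleftrightarrow>
     (\<forall>p\<in>P. \<forall>r>0. eventually (\<lambda>(x, y). p (\<phi> x - \<phi> y) < r) uniformity)" (is "?L = ?R")
proof
  assume L: ?L
  show ?R
  proof (intro ballI allI impI)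
    fix p and r :: real assume p: "p \<in> P" "0 < r"
    then have "openin (seminorm_topology P) {y. p (y - 0) < r}" by (rule openin_seminorm_ball)
    moreover have "0 \<in> {y. p (y - 0) < r}" using p ultra_seminormD(2)[OF bspec[OF P p(1)]] by simp
    ultimately have "eventually (\<lambda>(x, y). \<phi> x - \<phi> y \<in> {y. p (y - 0) < r}) uniformity"
      using L uniformly_continuous_into_iff[of "seminorm_topology P" \<phi>]
      unfolding topspace_seminorm_topology by blast
    then show "eventually (\<lambda>(x, y). p (\<phi> x - \<phi> y) < r) uniformity" by simp
  qed
next
  assume R: ?R
  show ?L
  proof (subst uniformly_continuous_into_iff, simp, intro allI impI)
    fix U assume U: "openin (seminorm_topology P) U \<and> 0 \<in> U"
    then have "openin (seminorm_topology P) U" by blast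
    then have "\<forall>x\<in>U. \<exists>F r. finite F \<and> F \<subseteq> P \<and> 0 < r \<and> {y. \<forall>p\<in>F. p (y - x) < r} \<subseteq> U"
      using openin_seminorm_topology[OF bspec[OF P]] by simp
    from bspec[OF this, of 0] U
    obtain F r where F: "finite F" "F \<subseteq> P" "(0::real) < r" "{y. \<forall>p\<in>F. p (y - 0) < r} \<subseteq> U"
      by (elim exE conjE) auto
    have "eventually (\<lambda>z. \<forall>p\<in>F. (case z of (x, y) \<Rightarrow> p (\<phi> x - \<phi> y) < r)) uniformity"
      using F R by (intro eventually_ball_finite) auto
    then show "eventually (\<lambda>(x, y). \<phi> x - \<phi> y \<in> U) uniformity"
      by (rule eventually_mono) (use F in auto)
  qed
qed

lemma openin_valuation_topology:
  assumes "NA_valuation v"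
  shows "openin (valuation_topology v) U \<longleftrightarrow> (\<forall>a\<in>U. \<exists>r>0. {b. v (b - a) < r} \<subseteq> U)"
    and "topspace (valuation_topology v) = UNIV"
    and "0 < r \<Longrightarrow> openin (valuation_topology v) {b. v (b - a) < r}"
proof -
  have sym: "v (a - b) = v (b - a)" for a b
  proof -
    have "v (x * y) = v x * v y" for x y using assms by (simp add: NA_valuation_def)
    from this[of "-1" "b - a"] show ?thesis using NA_valuation_one(2)[OF assms] by simp
  qed
  have tri: "v (a - c) \<le> max (v (a - b)) (v (b - c))" for a b c
  proof -
    have "v (x + y) \<le> max (v x) (v y)" for x y using assms by (simp add: NA_valuation_def)
    from this[of "a - b" "b - c"] show ?thesis by simp
  qed
  have nn: "0 \<le> v a" "v a = 0 \<longleftrightarrow> a = 0" for a using assms by (auto simp: NA_valuation_def)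
  interpret Metric_space UNIV "\<lambda>x y. v (x - y)"
  proof
    show "v (x - z) \<le> v (x - y) + v (y - z)" for x y z
      using tri[of x z y] nn(1)[of "x - y"] nn(1)[of "y - z"] by linarith
  qed (use sym nn in auto)
  show 1: "openin (valuation_topology v) U \<longleftrightarrow> (\<forall>a\<in>U. \<exists>r>0. {b. v (b - a) < r} \<subseteq> U)" for U
    unfolding valuation_topology_def openin_mtopology by (simp add: mball_def sym Ball_def)
  show "topspace (valuation_topology v) = UNIV"
    unfolding valuation_topology_def by simp
  show "openin (valuation_topology v) {b. v (b - a) < r}" if "0 < r"
    unfolding 1
  proof (intro ballI exI conjI)
    show "{c. v (c - b) < r} \<subseteq> {b. v (b - a) < r}" if "b \<in> {b. v (b - a) < r}" for b
    proof
      fix c assume "c \<in> {c. v (c - b) < r}"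
      then show "c \<in> {b. v (b - a) < r}" using that tri[of c a b] by auto
    qed
  qed (rule that)
qed

lemma NA_locally_convex_seminorm_topology:
  assumes v: "NA_valuation v" and s: "vector_space s"
    and P: "\<And>p. p \<in> P \<Longrightarrow> ultra_seminorm v s p"
    and sep: "\<And>x. x \<noteq> 0 \<Longrightarrow> \<exists>p\<in>P. p x \<noteq> 0"
  shows "NA_locally_convex v s (seminorm_topology P)"
proof -
  interpret vector_space s by fact
  let ?T = "seminorm_topology P"
  note D = ultra_seminormD[OF P]
  have D33: "p (a + (b + c)) \<le> max (p a) (max (p b) (p c))" if "p \<in> P" for p a b c
    using D(3)[OF that, of a "b + c"] D(3)[OF that, of b c] by linarith
  have neg: "p (- x) = p x" if "p \<in> P" for p x using ultra_seminorm_uminus[OF v s P[OF that]] .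
  have "continuous_map (prod_topology ?T ?T) ?T (\<lambda>(x, y). x + y)"
    unfolding continuous_map_seminorm_topology
  proof (intro ballI allI impI)
    fix p c and r :: real assume p: "p \<in> P" "0 < r"
    show "openin (prod_topology ?T ?T) {z \<in> topspace (prod_topology ?T ?T). p ((case z of (x, y) \<Rightarrow> x + y) - c) < r}"
      unfolding openin_prod_topology_alt
    proof (intro allI impI)
      fix x y assume "(x, y) \<in> {z \<in> topspace (prod_topology ?T ?T). p ((case z of (x, y) \<Rightarrow> x + y) - c) < r}"
      then have xy: "p (x + y - c) < r" by simp
      let ?U = "{z. p (z - x) < r}" and ?V = "{z. p (z - y) < r}"
      have "p (a + b - c) < r" if "p (a - x) < r" "p (b - y) < r" for a b
      proof -
        have "a + b - c = (a - x) + ((b - y) + (x + y - c))" by simp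
        then have "p (a + b - c) \<le> max (p (a - x)) (max (p (b - y)) (p (x + y - c)))"
          using D33[OF p(1)] by metis
        then show ?thesis using that xy by simp
      qed
      then show "\<exists>U V. openin ?T U \<and> openin ?T V \<and> x \<in> U \<and> y \<in> V \<and>
          U \<times> V \<subseteq> {z \<in> topspace (prod_topology ?T ?T). p ((case z of (x, y) \<Rightarrow> x + y) - c) < r}"
        using openin_seminorm_ball[OF p] p D(2)[OF p(1)]
        by (intro exI[of _ ?U] exI[of _ ?V]) auto
    qed
  qed
  moreover have "continuous_map ?T ?T uminus"
    unfolding continuous_map_seminorm_topology
  proof (intro ballI allI impI)
    fix p c and r :: real assume p: "p \<in> P" "0 < r"
    have "p (- x - c) = p (x - (- c))" for x
      using neg[OF p(1), of "x + c"] by simp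
    then show "openin ?T {x \<in> topspace ?T. p (- x - c) < r}"
      using openin_seminorm_ball[OF p, of "- c"] by simp
  qed
  moreover have "continuous_map (prod_topology (valuation_topology v) ?T) ?T (\<lambda>(a, x). s a x)"
    unfolding continuous_map_seminorm_topology
  proof (intro ballI allI impI)
    fix p c and r :: real assume p: "p \<in> P" "0 < r"
    let ?W = "{z \<in> topspace (prod_topology (valuation_topology v) ?T). p ((case z of (x, y) \<Rightarrow> s x y) - c) < r}"
    show "openin (prod_topology (valuation_topology v) ?T) ?W"
      unfolding openin_prod_topology_alt
    proof (intro allI impI)
      fix a x assume "(a, x) \<in> ?W"
      then have ax: "p (s a x - c) < r" by simp
      have nn: "0 \<le> p x" "0 \<le> v a" using D(1)[OF p(1)] v by (auto simp: NA_valuation_def)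
      define d where "d = min 1 (r / (p x + 1))"
      define e where "e = r / (v a + 1)"
      have de: "0 < d" "0 < e" using p nn by (auto simp: d_def e_def)
      let ?U = "{b. v (b - a) < d}" and ?V = "{y. p (y - x) < e}"
      have "p (s b y - c) < r" if b: "v (b - a) < d" and y: "p (y - x) < e" for b y
      proof -
        have "v b \<le> max (v (b - a)) (v a)" using v unfolding NA_valuation_def by (metis diff_add_cancel)
        then have "v b \<le> v a + 1" using b nn by (auto simp: d_def)
        then have "v b * p (y - x) \<le> (v a + 1) * p (y - x)"
          using D(1)[OF p(1)] by (intro mult_right_mono)
        also have "\<dots> < (v a + 1) * e" using y nn by (intro mult_strict_left_mono) auto
        also have "\<dots> = r" using nn by (simp add: e_def)
        finally have 1: "p (s b (y - x)) < r" using D(4)[OF p(1)] by simp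
        have "v (b - a) * p x \<le> d * p x" using b nn by (intro mult_right_mono) auto
        also have "\<dots> \<le> r / (p x + 1) * p x" using nn by (intro mult_right_mono) (auto simp: d_def)
        also have "\<dots> < r" using nn p by (simp add: field_simps)
        finally have 2: "p (s (b - a) x) < r" using D(4)[OF p(1)] by simp
        have "s b y - c = s b (y - x) + (s (b - a) x + (s a x - c))"
          by (simp add: scale_right_diff_distrib scale_left_diff_distrib)
        then have "p (s b y - c) \<le> max (p (s b (y - x))) (max (p (s (b - a) x)) (p (s a x - c)))"
          using D33[OF p(1)] by metis
        then show ?thesis using 1 2 ax by simp
      qed
      then have "?U \<times> ?V \<subseteq> ?W"
        by (auto simp: openin_valuation_topology[OF v])
      moreover have "v 0 = 0" using v by (simp add: NA_valuation_def)
      then have "a \<in> ?U" "x \<in> ?V" using de D(2)[OF p(1)] by auto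
      ultimately show "\<exists>U V. openin (valuation_topology v) U \<and> openin ?T V \<and> a \<in> U \<and> x \<in> V \<and> U \<times> V \<subseteq> ?W"
        using openin_seminorm_ball[OF p(1) de(2)] openin_valuation_topology(3)[OF v de(1)]
        by (intro exI[of _ ?U] exI[of _ ?V]) auto
    qed
  qed
  moreover have "Hausdorff_space ?T"
    unfolding Hausdorff_space_def
  proof (intro allI impI)
    fix x y assume "x \<in> topspace ?T \<and> y \<in> topspace ?T \<and> x \<noteq> y"
    then obtain p where p: "p \<in> P" "p (x - y) \<noteq> 0" using sep[of "x - y"] by auto
    define r where "r = p (x - y)"
    have r: "0 < r" using p D(1)[OF p(1)] by (simp add: r_def less_le)
    let ?U = "{z. p (z - x) < r}" and ?V = "{z. p (z - y) < r}"
    have "p (x - y) < r" if "p (z - x) < r" "p (z - y) < r" for z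
    proof -
      have "p (x - y) \<le> max (p (x - z)) (p (z - y))"
        using D(3)[OF p(1), of "x - z" "z - y"] by simp
      moreover have "p (x - z) = p (z - x)" using neg[OF p(1), of "z - x"] by simp
      ultimately show ?thesis using that by simp
    qed
    then have "disjnt ?U ?V" by (auto simp: disjnt_iff r_def)
    then show "\<exists>U V. openin ?T U \<and> openin ?T V \<and> x \<in> U \<and> y \<in> V \<and> disjnt U V"
      using openin_seminorm_ball[OF p(1) r] r D(2)[OF p(1)]
      by (intro exI[of _ ?U] exI[of _ ?V]) auto
  qed
  ultimately show ?thesis
    using s P by (auto simp: NA_locally_convex_def topological_abelian_group_def)
qed

lemma lookup_vec_scale [simp]: "Poly_Mapping.lookup (vec_scale a u) x = a * Poly_Mapping.lookup u x"
  by (simp add: vec_scale_def Poly_Mapping.map.rep_eq when_def)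

lemma lookup_vec_of: "Poly_Mapping.lookup (vec_of x) y = (if x = y then 1 else 0)"
  by (simp add: vec_of_def lookup_single when_def)

lemma vector_space_vec_scale: "vector_space vec_scale"
  by unfold_locales (auto intro!: poly_mapping_eqI simp: lookup_add algebra_simps)

lemma vector_space_times: "vector_space ((*) :: 'f::field \<Rightarrow> 'f \<Rightarrow> 'f)"
  by unfold_locales (auto simp: algebra_simps)

definition vec_extension ::
    "('f::field \<Rightarrow> 'v::ab_group_add \<Rightarrow> 'v) \<Rightarrow> ('x \<Rightarrow> 'v) \<Rightarrow> ('x \<Rightarrow>\<^sub>0 'f) \<Rightarrow> 'v" where
  "vec_extension s \<phi> u = (\<Sum>x\<in>Poly_Mapping.keys u. s (Poly_Mapping.lookup u x) (\<phi> x))"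

lemma vec_extension_superset:
  assumes "vector_space s" "finite S" "Poly_Mapping.keys u \<subseteq> S"
  shows "vec_extension s \<phi> u = (\<Sum>x\<in>S. s (Poly_Mapping.lookup u x) (\<phi> x))"
proof -
  interpret vector_space s by fact
  show ?thesis unfolding vec_extension_def
    using assms(2,3) by (intro sum.mono_neutral_left) (auto simp: in_keys_iff)
qed

lemma linear_vec_extension:
  fixes s :: "'f::field \<Rightarrow> 'v::ab_group_add \<Rightarrow> 'v" and \<phi> :: "'x \<Rightarrow> 'v"
  assumes "vector_space s"
  shows "Vector_Spaces.linear vec_scale s (vec_extension s \<phi>)"
proof -
  interpret s: vector_space s by fact
  interpret vs: vector_space "vec_scale :: 'f \<Rightarrow> ('x \<Rightarrow>\<^sub>0 'f) \<Rightarrow> _" by (rule vector_space_vec_scale)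
  show ?thesis
  proof unfold_locales
    fix u w :: "'x \<Rightarrow>\<^sub>0 'f"
    let ?S = "Poly_Mapping.keys u \<union> Poly_Mapping.keys w"
    have "Poly_Mapping.keys (u + w) \<subseteq> ?S" by (rule keys_add)
    then show "vec_extension s \<phi> (u + w) = vec_extension s \<phi> u + vec_extension s \<phi> w"
      by (simp add: vec_extension_superset[OF assms, of ?S] lookup_add s.scale_left_distrib sum.distrib)
  next
    fix a and u :: "'x \<Rightarrow>\<^sub>0 'f"
    have "Poly_Mapping.keys (vec_scale a u) \<subseteq> Poly_Mapping.keys u" by (auto simp: in_keys_iff)
    then show "vec_extension s \<phi> (vec_scale a u) = s a (vec_extension s \<phi> u)"
      by (simp add: vec_extension_superset[OF assms, of "Poly_Mapping.keys u"] s.scale_sum_right)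
  qed
qed

lemma vec_extension_vec_of:
  assumes "vector_space s" shows "vec_extension s \<phi> (vec_of x) = \<phi> x"
proof -
  interpret vector_space s by fact
  have "vec_extension s \<phi> (vec_of x) = (\<Sum>y\<in>{x}. s (Poly_Mapping.lookup (vec_of x) y) (\<phi> y))"
    by (rule vec_extension_superset[OF assms]) (auto simp: vec_of_def)
  then show ?thesis by (simp add: lookup_vec_of)
qed

lemma vec_expansion: "u = (\<Sum>x\<in>Poly_Mapping.keys u. vec_scale (Poly_Mapping.lookup u x) (vec_of x))"
proof (rule poly_mapping_eqI)
  fix y
  show "Poly_Mapping.lookup u y = Poly_Mapping.lookup (\<Sum>x\<in>Poly_Mapping.keys u. vec_scale (Poly_Mapping.lookup u x) (vec_of x)) y"
    by (auto simp: lookup_sum lookup_vec_of if_distrib[of "\<lambda>z. _ * z"] in_keys_iff cong: if_cong)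
qed

lemma linear_eq_vec_extension:
  assumes "Vector_Spaces.linear vec_scale s \<Phi>" "\<And>x. \<Phi> (vec_of x) = \<phi> x"
  shows "\<Phi> = vec_extension s \<phi>"
proof
  fix u
  interpret Vector_Spaces.linear vec_scale s \<Phi> by fact
  have "\<Phi> u = \<Phi> (\<Sum>x\<in>Poly_Mapping.keys u. vec_scale (Poly_Mapping.lookup u x) (vec_of x))"
    using vec_expansion[of u] by simp
  also have "\<dots> = vec_extension s \<phi> u" by (simp add: sum scale assms(2) vec_extension_def)
  finally show "\<Phi> u = vec_extension s \<phi> u" .
qed

definition free_seminorms ::
    "('f::field \<Rightarrow> real) \<Rightarrow> (('x::uniform_space \<Rightarrow>\<^sub>0 'f) \<Rightarrow> real) set" where
  "free_seminorms v = {p. ultra_seminorm v vec_scale p \<and>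
     (\<forall>r>0. eventually (\<lambda>(x, y). p (vec_of x - vec_of y) < r) uniformity)}"

lemma ultra_seminorm_compose:
  assumes "ultra_seminorm v s q" "Vector_Spaces.linear t s \<Phi>"
  shows "ultra_seminorm v t (\<lambda>u. q (\<Phi> u))"
proof -
  interpret Vector_Spaces.linear t s \<Phi> by fact
  show ?thesis using assms(1) by (auto simp: ultra_seminorm_def add scale)
qed

lemma NA_separating_entourage:
  fixes x0 :: "'x::{uniform_space, t2_space}"
  assumes "NA_uniformity (uniformity :: ('x \<times> 'x) filter)" "finite S"
  obtains R where "equiv UNIV R" "eventually (\<lambda>z. z \<in> R) uniformity"
    "\<And>x. x \<in> S \<Longrightarrow> x \<noteq> x0 \<Longrightarrow> (x0, x) \<notin> R"
proof -
  let ?E = "{(x, y). x = x0 \<longrightarrow> y \<notin> S - {x0}}"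
  have "open (- (S - {x0}))" using assms(2) by (intro open_Compl finite_imp_closed) auto
  then have "eventually (\<lambda>y. y \<in> - (S - {x0})) (nhds x0)"
    by (rule eventually_nhds_in_open) auto
  then have "eventually (\<lambda>(x, y). x = x0 \<longrightarrow> y \<in> - (S - {x0})) uniformity"
    by (simp only: eventually_nhds_uniformity)
  then have "eventually (\<lambda>z. z \<in> ?E) uniformity"
    by (rule eventually_mono) auto
  then obtain R where "equiv UNIV R" "eventually (\<lambda>z. z \<in> R) uniformity" "R \<subseteq> ?E"
    using assms(1) unfolding NA_uniformity_def by blast
  then show thesis using that by blast
qed

lemma free_seminorms_separate:
  fixes u :: "'x::{uniform_space, t2_space} \<Rightarrow>\<^sub>0 'f::field"
  assumes v: "NA_valuation v" and NA: "NA_uniformity (uniformity :: ('x \<times> 'x) filter)" and "u \<noteq> 0"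
  shows "\<exists>p\<in>free_seminorms v. p u \<noteq> 0"
proof -
  obtain x0 where x0: "x0 \<in> Poly_Mapping.keys u" using \<open>u \<noteq> 0\<close> by fastforce
  obtain R where R: "equiv UNIV R" "eventually (\<lambda>z. z \<in> R) uniformity"
    "\<And>x. x \<in> Poly_Mapping.keys u \<Longrightarrow> x \<noteq> x0 \<Longrightarrow> (x0, x) \<notin> R"
    using NA_separating_entourage[OF NA finite_keys[of u], of x0] by metis
  define ch :: "'x \<Rightarrow> 'f" where "ch x = (if (x0, x) \<in> R then 1 else 0)" for x
  define l where "l = vec_extension (*) ch"
  have lin: "Vector_Spaces.linear vec_scale (*) l"
    unfolding l_def by (rule linear_vec_extension[OF vector_space_times])
  have l_of: "l (vec_of x) = ch x" for x
    unfolding l_def by (rule vec_extension_vec_of[OF vector_space_times])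
  have "ultra_seminorm v (*) v" using v by (auto simp: ultra_seminorm_def NA_valuation_def)
  then have 1: "ultra_seminorm v vec_scale (\<lambda>w. v (l w))" by (rule ultra_seminorm_compose[OF _ lin])
  have 2: "eventually (\<lambda>(x, y). v (l (vec_of x - vec_of y)) < r) uniformity" if "0 < r" for r
  proof (rule eventually_mono[OF R(2)])
    fix z assume z: "z \<in> R"
    obtain x y where xy: "z = (x, y)" by (cases z)
    have "(x0, x) \<in> R \<longleftrightarrow> (x0, y) \<in> R"
      using z R(1) unfolding xy equiv_def by (meson symD transD)
    then have "ch x = ch y" by (simp add: ch_def)
    interpret Vector_Spaces.linear vec_scale "(*)" l by (rule lin)
    have "l (vec_of x - vec_of y) = 0" using \<open>ch x = ch y\<close> by (simp add: diff l_of)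
    moreover have "v 0 = 0" using v by (simp add: NA_valuation_def)
    ultimately show "case z of (x, y) \<Rightarrow> v (l (vec_of x - vec_of y)) < r" using that xy by simp
  qed
  have "(x0, x0) \<in> R" using R(1) by (simp add: equiv_def refl_on_def)
  then have "ch x0 = 1" by (simp add: ch_def)
  have "l u = (\<Sum>x\<in>Poly_Mapping.keys u. Poly_Mapping.lookup u x * ch x)" by (simp add: l_def vec_extension_def)
  also have "\<dots> = (\<Sum>x\<in>{x0}. Poly_Mapping.lookup u x * ch x)"
    using R(3) x0 by (intro sum.mono_neutral_right) (auto simp: ch_def)
  finally have "l u = Poly_Mapping.lookup u x0" using \<open>ch x0 = 1\<close> by simp
  then have "v (l u) \<noteq> 0" using x0 v by (simp add: in_keys_iff NA_valuation_def)
  then show ?thesis using 1 2 by (intro bexI[of _ "\<lambda>w. v (l w)"]) (auto simp: free_seminorms_def)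
qed

lemma free_NA_locally_convex_seminorm_topology:
  assumes v: "NA_valuation v" and NA: "NA_uniformity (uniformity :: ('x::{uniform_space, t2_space} \<times> 'x) filter)"
  shows "free_NA_locally_convex_for TYPE('v::ab_group_add) v
           (seminorm_topology (free_seminorms v :: (('x \<Rightarrow>\<^sub>0 'f::field) \<Rightarrow> real) set))"
proof -
  let ?P = "free_seminorms v :: (('x \<Rightarrow>\<^sub>0 'f) \<Rightarrow> real) set"
  let ?T = "seminorm_topology ?P"
  have P0: "\<forall>p\<in>?P. ultra_seminorm v vec_scale p" by (simp add: free_seminorms_def)
  note P = bspec[OF P0]
  have "NA_locally_convex v vec_scale ?T"
    by (rule NA_locally_convex_seminorm_topology[OF v vector_space_vec_scale P
          free_seminorms_separate[OF v NA]])
  moreover have "uniformly_continuous_into ?T vec_of"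
    unfolding uniformly_continuous_into_seminorm_topology[OF P0] by (simp add: free_seminorms_def)
  moreover have "\<exists>!\<Phi>. Vector_Spaces.linear vec_scale s \<Phi> \<and> continuous_map ?T T' \<Phi> \<and> (\<forall>x. \<Phi> (vec_of x) = \<phi> x)"
    if T': "NA_locally_convex v s T'" and \<phi>: "uniformly_continuous_into T' \<phi>"
    for s :: "'f \<Rightarrow> 'v \<Rightarrow> 'v" and T' and \<phi> :: "'x \<Rightarrow> 'v"
  proof (rule ex1I)
    obtain Q where Q0: "\<forall>q\<in>Q. ultra_seminorm v s q" and Q2: "T' = seminorm_topology Q"
      using T' by (auto simp: NA_locally_convex_def)
    note Q = bspec[OF Q0] Q2
    have s: "vector_space s" using T' by (simp add: NA_locally_convex_def)
    let ?\<Phi> = "vec_extension s \<phi>"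
    have lin: "Vector_Spaces.linear vec_scale s ?\<Phi>" by (rule linear_vec_extension[OF s])
    interpret Vector_Spaces.linear vec_scale s ?\<Phi> by (rule lin)
    have ext: "?\<Phi> (vec_of x) = \<phi> x" for x by (rule vec_extension_vec_of[OF s])
    have "continuous_map ?T T' ?\<Phi>"
      unfolding Q(2) continuous_map_seminorm_topology
    proof (intro ballI allI impI)
      fix q c and r :: real assume q: "q \<in> Q" "0 < r"
      have qP: "(\<lambda>u. q (?\<Phi> u)) \<in> ?P"
        using \<phi> q ultra_seminorm_compose[OF Q(1)[OF q(1)] lin]
        unfolding Q(2) uniformly_continuous_into_seminorm_topology[OF Q0] free_seminorms_def
        by (simp add: diff ext)
      show "openin ?T {u \<in> topspace ?T. q (?\<Phi> u - c) < r}"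
      proof (subst openin_subopen, intro ballI)
        fix u assume "u \<in> {u \<in> topspace ?T. q (?\<Phi> u - c) < r}"
        then have u: "q (?\<Phi> u - c) < r" by simp
        let ?B = "{w. q (?\<Phi> (w - u)) < r}"
        have "openin ?T ?B" using openin_seminorm_ball[OF qP q(2), of u] by simp
        moreover have "u \<in> ?B" using q ultra_seminormD(2)[OF Q(1)[OF q(1)]] by (simp add: zero)
        moreover have "q (?\<Phi> w - c) < r" if "q (?\<Phi> (w - u)) < r" for w
        proof -
          have "q (?\<Phi> (w - u) + (?\<Phi> u - c)) \<le> max (q (?\<Phi> (w - u))) (q (?\<Phi> u - c))"
            by (rule ultra_seminormD(3)[OF Q(1)[OF q(1)]])
          then show ?thesis using u that by (simp add: diff)
        qed
        ultimately show "\<exists>W. openin ?T W \<and> u \<in> W \<and> W \<subseteq> {u \<in> topspace ?T. q (?\<Phi> u - c) < r}"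
          by (intro exI[of _ ?B]) auto
      qed
    qed
    then show "Vector_Spaces.linear vec_scale s ?\<Phi> \<and> continuous_map ?T T' ?\<Phi> \<and> (\<forall>x. ?\<Phi> (vec_of x) = \<phi> x)"
      using lin ext by blast
    show "\<Psi> = ?\<Phi>" if "Vector_Spaces.linear vec_scale s \<Psi> \<and> continuous_map ?T T' \<Psi> \<and> (\<forall>x. \<Psi> (vec_of x) = \<phi> x)" for \<Psi>
      using that linear_eq_vec_extension by blast
  qed
  ultimately show ?thesis unfolding free_NA_locally_convex_for_def by blast
qed

theorem free_NA_locally_convex_iff:
  fixes T :: "('x::{uniform_space, t2_space} \<Rightarrow>\<^sub>0 'f::field) topology"
  assumes v: "NA_valuation v" and NA: "NA_uniformity (uniformity :: ('x \<times> 'x) filter)"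
  shows "free_NA_locally_convex v T \<longleftrightarrow> T = seminorm_topology (free_seminorms v)"
proof
  assume T: "free_NA_locally_convex v T"
  let ?P = "free_seminorms v :: (('x \<Rightarrow>\<^sub>0 'f) \<Rightarrow> real) set"
  let ?T = "seminorm_topology ?P"
  have P0: "\<forall>p\<in>?P. ultra_seminorm v vec_scale p" by (simp add: free_seminorms_def)
  note P = bspec[OF P0]
  have free: "NA_locally_convex v vec_scale ?T" "uniformly_continuous_into ?T vec_of"
    using free_NA_locally_convex_seminorm_topology[OF v NA, where ?'v = "'x \<Rightarrow>\<^sub>0 'f"]
    unfolding free_NA_locally_convex_for_def by blast+
  have lc: "NA_locally_convex v vec_scale T" and uc: "uniformly_continuous_into T vec_of"
    using T unfolding free_NA_locally_convex_def free_NA_locally_convex_for_def by blast+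
  obtain Q where Q0: "\<forall>q\<in>Q. ultra_seminorm v vec_scale q" and Q2: "T = seminorm_topology Q"
    using lc by (auto simp: NA_locally_convex_def)
  note Q = bspec[OF Q0] Q2
  have "Q \<subseteq> ?P"
    using uc Q(1) unfolding Q(2) uniformly_continuous_into_seminorm_topology[OF Q0]
    by (auto simp: free_seminorms_def)
  then have 1: "continuous_map ?T T id"
    unfolding Q(2) continuous_map_seminorm_topology
    by (auto intro!: openin_seminorm_ball)
  obtain \<Phi> where \<Phi>: "Vector_Spaces.linear vec_scale vec_scale \<Phi>" "continuous_map T ?T \<Phi>"
      "\<And>x. \<Phi> (vec_of x) = vec_of x"
  proof -
    have "\<forall>(s :: 'f \<Rightarrow> ('x \<Rightarrow>\<^sub>0 'f) \<Rightarrow> 'x \<Rightarrow>\<^sub>0 'f) T' \<phi>.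
        NA_locally_convex v s T' \<and> uniformly_continuous_into T' \<phi> \<longrightarrow>
        (\<exists>!\<Phi>. Vector_Spaces.linear vec_scale s \<Phi> \<and> continuous_map T T' \<Phi> \<and> (\<forall>x. \<Phi> (vec_of x) = \<phi> x))"
      using T unfolding free_NA_locally_convex_def free_NA_locally_convex_for_def by simp
    from this[rule_format, OF conjI[OF free]] show thesis using that by blast
  qed
  have "Vector_Spaces.linear vec_scale vec_scale (id :: ('x \<Rightarrow>\<^sub>0 'f) \<Rightarrow> 'x \<Rightarrow>\<^sub>0 'f)"
    by (rule vector_space.linear_id[OF vector_space_vec_scale])
  then have "id = vec_extension vec_scale (vec_of :: 'x \<Rightarrow> 'x \<Rightarrow>\<^sub>0 'f)"
    by (rule linear_eq_vec_extension) simp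
  then have "\<Phi> = id" using linear_eq_vec_extension[OF \<Phi>(1,3)] by simp
  with \<Phi>(2) have 2: "continuous_map T ?T id" by simp
  have "topspace T = UNIV" by (simp add: Q(2))
  then show "T = ?T"
    using 1 2 unfolding topology_eq continuous_map_def by (auto simp: id_def)
next
  assume "T = seminorm_topology (free_seminorms v)"
  then show "free_NA_locally_convex v T"
    using free_NA_locally_convex_seminorm_topology[OF v NA] by (simp add: free_NA_locally_convex_def)
qed

theorem free_NA_locally_convex_universal:
  fixes T :: "('x::{uniform_space, t2_space} \<Rightarrow>\<^sub>0 'f::field) topology"
  assumes "NA_valuation v" and "NA_uniformity (uniformity :: ('x \<times> 'x) filter)"
    and "free_NA_locally_convex v T"
  shows "free_NA_locally_convex_for TYPE('v::ab_group_add) v T"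
proof -
  have "T = seminorm_topology (free_seminorms v)"
    using free_NA_locally_convex_iff[OF assms(1,2)] assms(3) by simp
  then show ?thesis
    using free_NA_locally_convex_seminorm_topology[OF assms(1,2)] by simp
qed

subsection \<open>Abelian groups\<close>

definition int_multiple :: "int \<Rightarrow> 'g::ab_group_add \<Rightarrow> 'g" where
  "int_multiple k g = (\<Sum>i<nat k. g) - (\<Sum>i<nat (- k). g)"

lemma int_multiple_0 [simp]: "int_multiple 0 g = 0" and int_multiple_1 [simp]: "int_multiple 1 g = g"
  by (simp_all add: int_multiple_def)

lemma int_multiple_add: "int_multiple (k + l) g = int_multiple k g + int_multiple l g"
proof -
  define S where "S n = (\<Sum>i<n. g)" for n :: nat
  have S: "S (m + n) = S m + S n" for m n by (induction n) (simp_all add: S_def add.assoc)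
  have "nat (k + l) + (nat (- k) + nat (- l)) = nat (- (k + l)) + (nat k + nat l)" by linarith
  then have "S (nat (k + l)) + (S (nat (- k)) + S (nat (- l))) = S (nat (- (k + l))) + (S (nat k) + S (nat l))"
    by (metis S)
  then show ?thesis unfolding int_multiple_def S_def[symmetric] by (simp add: algebra_simps)
qed

definition frag_extension :: "('x \<Rightarrow> 'g::ab_group_add) \<Rightarrow> ('x \<Rightarrow>\<^sub>0 int) \<Rightarrow> 'g" where
  "frag_extension \<phi> u = (\<Sum>x\<in>Poly_Mapping.keys u. int_multiple (Poly_Mapping.lookup u x) (\<phi> x))"

lemma frag_extension_superset:
  assumes "finite S" "Poly_Mapping.keys u \<subseteq> S"
  shows "frag_extension \<phi> u = (\<Sum>x\<in>S. int_multiple (Poly_Mapping.lookup u x) (\<phi> x))"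
  unfolding frag_extension_def
  using assms by (intro sum.mono_neutral_left) (auto simp: in_keys_iff)

lemma additive_frag_extension: "Modules.additive (frag_extension \<phi>)"
proof
  fix u w :: "'a \<Rightarrow>\<^sub>0 int"
  let ?S = "Poly_Mapping.keys u \<union> Poly_Mapping.keys w"
  have "Poly_Mapping.keys (u + w) \<subseteq> ?S" by (rule keys_add)
  then show "frag_extension \<phi> (u + w) = frag_extension \<phi> u + frag_extension \<phi> w"
    by (simp add: frag_extension_superset[of ?S] lookup_add int_multiple_add sum.distrib)
qed

lemma frag_extension_frag_of: "frag_extension \<phi> (frag_of x) = \<phi> x"
  by (simp add: frag_extension_def)

lemma additive_eq_on_frag_of:
  fixes \<Phi> \<Psi> :: "('a \<Rightarrow>\<^sub>0 int) \<Rightarrow> 'g::ab_group_add"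
  assumes "Modules.additive \<Phi>" "Modules.additive \<Psi>" "\<And>x. \<Phi> (frag_of x) = \<Psi> (frag_of x)"
  shows "\<Phi> = \<Psi>"
proof
  fix u :: "'a \<Rightarrow>\<^sub>0 int"
  interpret \<Phi>: Modules.additive \<Phi> by fact
  interpret \<Psi>: Modules.additive \<Psi> by fact
  have "Poly_Mapping.keys u \<subseteq> UNIV" by simp
  then show "\<Phi> u = \<Psi> u"
    by (induction u rule: frag_induction) (simp_all add: assms(3) \<Phi>.zero \<Psi>.zero \<Phi>.diff \<Psi>.diff)
qed

lemma additive_subgroupD:
  assumes "additive_subgroup H"
  shows "0 \<in> H" "x \<in> H \<Longrightarrow> y \<in> H \<Longrightarrow> x + y \<in> H" "x \<in> H \<Longrightarrow> - x \<in> H" "x \<in> H \<Longrightarrow> y \<in> H \<Longrightarrow> x - y \<in> H"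
proof -
  show 1: "0 \<in> H" "x \<in> H \<Longrightarrow> y \<in> H \<Longrightarrow> x + y \<in> H" "x \<in> H \<Longrightarrow> - x \<in> H" for x y
    using assms by (auto simp: additive_subgroup_def)
  show "x \<in> H \<Longrightarrow> y \<in> H \<Longrightarrow> x - y \<in> H" using 1(2)[of x "- y"] 1(3)[of y] by simp
qed

lemma openin_translation:
  assumes "topological_abelian_group T" "openin T U"
  shows "openin T {x. a + x \<in> U}"
proof -
  have T: "topspace T = UNIV" "continuous_map (prod_topology T T) T (\<lambda>(x, y). x + y)"
    using assms(1) by (auto simp: topological_abelian_group_def)
  have "continuous_map T (prod_topology T T) (\<lambda>x. (a, x))"
    by (simp add: continuous_map_pairwise o_def T)
  from continuous_map_compose[OF this T(2)] have "continuous_map T T (\<lambda>x. a + x)"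
    by (simp add: o_def)
  from openin_continuous_map_preimage[OF this assms(2)] show ?thesis by (simp add: T)
qed

definition free_subgroups :: "('x::uniform_space \<Rightarrow>\<^sub>0 int) set set" where
  "free_subgroups = {H. additive_subgroup H \<and>
     eventually (\<lambda>(x, y). frag_of x - frag_of y \<in> H) uniformity}"

definition free_group_topology :: "('x::uniform_space \<Rightarrow>\<^sub>0 int) topology" where
  "free_group_topology = topology (\<lambda>U. \<forall>u\<in>U. \<exists>H\<in>free_subgroups. \<forall>h\<in>H. u + h \<in> U)"

lemma free_subgroups_Int:
  assumes "H \<in> free_subgroups" "K \<in> free_subgroups" shows "H \<inter> K \<in> free_subgroups"
proof -
  have "eventually (\<lambda>z. (case z of (x, y) \<Rightarrow> frag_of x - frag_of y \<in> H) \<and>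
      (case z of (x, y) \<Rightarrow> frag_of x - frag_of y \<in> K)) uniformity"
    using assms by (intro eventually_conj) (auto simp: free_subgroups_def)
  then have "eventually (\<lambda>(x, y). frag_of x - frag_of y \<in> H \<inter> K) uniformity"
    by (rule eventually_mono) auto
  moreover have "additive_subgroup (H \<inter> K)"
    using assms by (auto simp: free_subgroups_def additive_subgroup_def)
  ultimately show ?thesis by (simp add: free_subgroups_def)
qed

lemma UNIV_free_subgroups: "UNIV \<in> free_subgroups"
  by (simp add: free_subgroups_def additive_subgroup_def case_prod_unfold)

lemma openin_free_group_topology:
  fixes U :: "('a::uniform_space \<Rightarrow>\<^sub>0 int) set"
  shows
  "openin free_group_topology U \<longleftrightarrow> (\<forall>u\<in>U. \<exists>H\<in>free_subgroups. \<forall>h\<in>H. u + h \<in> U)"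
proof -
  define L :: "('a \<Rightarrow>\<^sub>0 int) set \<Rightarrow> bool"
    where "L U \<longleftrightarrow> (\<forall>u\<in>U. \<exists>H\<in>free_subgroups. \<forall>h\<in>H. u + h \<in> U)" for U
  have "L (U \<inter> V)" if UV: "L U" "L V" for U V
    unfolding L_def
  proof
    fix u assume u: "u \<in> U \<inter> V"
    obtain H where H: "H \<in> free_subgroups" "\<forall>h\<in>H. u + h \<in> U" using UV(1) u by (auto simp: L_def)
    obtain K where K: "K \<in> free_subgroups" "\<forall>h\<in>K. u + h \<in> V" using UV(2) u by (auto simp: L_def)
    show "\<exists>H\<in>free_subgroups. \<forall>h\<in>H. u + h \<in> U \<inter> V"
      using H(2) K(2) by (intro bexI[OF _ free_subgroups_Int[OF H(1) K(1)]]) blast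
  qed
  moreover have "L (\<Union>K)" if K: "\<forall>U\<in>K. L U" for K
    unfolding L_def
  proof
    fix u assume "u \<in> \<Union>K"
    then obtain U where U: "U \<in> K" "u \<in> U" by blast
    obtain H where "H \<in> free_subgroups" "\<forall>h\<in>H. u + h \<in> U"
      using bspec[OF bspec[OF K U(1), unfolded L_def] U(2)] by (elim bexE)
    then show "\<exists>H\<in>free_subgroups. \<forall>h\<in>H. u + h \<in> \<Union>K" using U(1) by (intro bexI[of _ H]) auto
  qed
  ultimately have "istopology L" by (simp add: istopology_def)
  then have "istopology (\<lambda>U :: ('a \<Rightarrow>\<^sub>0 int) set. \<forall>u\<in>U. \<exists>H\<in>free_subgroups. \<forall>h\<in>H. u + h \<in> U)"
    by (simp add: L_def[abs_def])
  then show ?thesis unfolding free_group_topology_def by (simp add: topology_inverse')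
qed

lemma openin_free_coset:
  assumes "H \<in> free_subgroups" shows "openin free_group_topology {u. u - c \<in> H}"
  unfolding openin_free_group_topology
proof
  have H: "additive_subgroup H" using assms by (simp add: free_subgroups_def)
  fix u assume "u \<in> {u. u - c \<in> H}"
  then have "u + h - c \<in> H" if "h \<in> H" for h
    using additive_subgroupD(2)[OF H, of "u - c" h] that by (simp add: algebra_simps)
  then show "\<exists>H'\<in>free_subgroups. \<forall>h\<in>H'. u + h \<in> {u. u - c \<in> H}" using assms by (intro bexI[of _ H]) auto
qed

lemma topspace_free_group_topology: "topspace free_group_topology = UNIV"
proof -
  have "openin free_group_topology UNIV" using UNIV_free_subgroups by (auto simp: openin_free_group_topology)
  then show ?thesis using openin_subset by blast
qed

lemma NA_abelian_group_free_group_topology: "NA_abelian_group free_group_topology"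
proof -
  let ?T = "free_group_topology :: ('a \<Rightarrow>\<^sub>0 int) topology"
  note ts = topspace_free_group_topology
  have "continuous_map (prod_topology ?T ?T) ?T (\<lambda>(x, y). x + y)"
    unfolding continuous_map_def
  proof (intro conjI allI impI)
    fix U assume U: "openin ?T U"
    show "openin (prod_topology ?T ?T) {z \<in> topspace (prod_topology ?T ?T). (case z of (x, y) \<Rightarrow> x + y) \<in> U}"
      unfolding openin_prod_topology_alt
    proof (intro allI impI)
      fix x y assume "(x, y) \<in> {z \<in> topspace (prod_topology ?T ?T). (case z of (x, y) \<Rightarrow> x + y) \<in> U}"
      then obtain H where H: "H \<in> free_subgroups" "\<forall>h\<in>H. x + y + h \<in> U"
        using U unfolding openin_free_group_topology by auto
      have sub: "additive_subgroup H" using H(1) by (simp add: free_subgroups_def)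
      have "a + b \<in> U" if "a - x \<in> H" "b - y \<in> H" for a b
      proof -
        have "x + y + ((a - x) + (b - y)) \<in> U" using H(2) additive_subgroupD(2)[OF sub that] by blast
        then show ?thesis by (simp add: algebra_simps)
      qed
      then show "\<exists>V W. openin ?T V \<and> openin ?T W \<and> x \<in> V \<and> y \<in> W \<and>
          V \<times> W \<subseteq> {z \<in> topspace (prod_topology ?T ?T). (case z of (x, y) \<Rightarrow> x + y) \<in> U}"
        using openin_free_coset[OF H(1)] additive_subgroupD(1)[OF sub]
        by (intro exI[of _ "{u. u - x \<in> H}"] exI[of _ "{u. u - y \<in> H}"]) (auto simp: ts)
    qed
  qed (simp add: ts)
  moreover have "continuous_map ?T ?T uminus"
    unfolding continuous_map_def
  proof (intro conjI allI impI)
    fix U assume U: "openin ?T U"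
    show "openin ?T {x \<in> topspace ?T. - x \<in> U}"
      unfolding openin_free_group_topology
    proof
      fix x assume "x \<in> {x \<in> topspace ?T. - x \<in> U}"
      then obtain H where H: "H \<in> free_subgroups" "\<forall>h\<in>H. - x + h \<in> U"
        using U unfolding openin_free_group_topology by auto
      have sub: "additive_subgroup H" using H(1) by (simp add: free_subgroups_def)
      have "- (x + h) \<in> U" if "h \<in> H" for h
        using bspec[OF H(2) additive_subgroupD(3)[OF sub that]] by simp
      then show "\<exists>H\<in>free_subgroups. \<forall>h\<in>H. x + h \<in> {x \<in> topspace ?T. - x \<in> U}"
        using H(1) by (intro bexI[of _ H]) (auto simp: ts)
    qed
  qed (simp add: ts)
  moreover have "\<exists>H. openin ?T H \<and> additive_subgroup H \<and> H \<subseteq> U" if U: "openin ?T U" and 0: "0 \<in> U" for U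
  proof -
    obtain H where H: "H \<in> free_subgroups" "\<forall>h\<in>H. 0 + h \<in> U"
      using bspec[OF U[unfolded openin_free_group_topology] 0] by (elim bexE)
    then show ?thesis
      using openin_free_coset[OF H(1), of 0] by (intro exI[of _ H]) (auto simp: free_subgroups_def)
  qed
  ultimately show ?thesis by (auto simp: NA_abelian_group_def topological_abelian_group_def ts)
qed

lemma free_NA_abelian_group_topology:
  "free_NA_abelian_group_for TYPE('g::ab_group_add) free_group_topology"
proof -
  let ?T = "free_group_topology :: ('a \<Rightarrow>\<^sub>0 int) topology"
  have "uniformly_continuous_into ?T frag_of"
  proof (subst uniformly_continuous_into_iff)
    show "\<forall>U. openin ?T U \<and> 0 \<in> U \<longrightarrow> eventually (\<lambda>(x, y). frag_of x - frag_of y \<in> U) uniformity"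
    proof (intro allI impI)
      fix U assume U: "openin ?T U \<and> 0 \<in> U"
      then obtain H where H: "H \<in> free_subgroups" "\<forall>h\<in>H. 0 + h \<in> U"
        unfolding openin_free_group_topology by blast
      have "eventually (\<lambda>(x, y). frag_of x - frag_of y \<in> H) uniformity"
        using H(1) by (simp add: free_subgroups_def)
      then show "eventually (\<lambda>(x, y). frag_of x - frag_of y \<in> U) uniformity"
        by (rule eventually_mono) (use H(2) in auto)
    qed
  qed (simp add: topspace_free_group_topology)
  moreover have "\<exists>!\<Phi>. Modules.additive \<Phi> \<and> continuous_map ?T T' \<Phi> \<and> (\<forall>x. \<Phi> (frag_of x) = \<phi> x)"
    if T': "NA_abelian_group T'" and \<phi>: "uniformly_continuous_into T' \<phi>"
    for T' :: "'g topology" and \<phi> :: "'a \<Rightarrow> 'g"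
  proof (rule ex1I)
    let ?\<Phi> = "frag_extension \<phi>"
    interpret Modules.additive ?\<Phi> by (rule additive_frag_extension)
    have tg: "topological_abelian_group T'" and ts: "topspace T' = UNIV"
      using T' by (auto simp: NA_abelian_group_def topological_abelian_group_def)
    have "continuous_map ?T T' ?\<Phi>"
      unfolding continuous_map_def
    proof (intro conjI allI impI)
      fix U assume U: "openin T' U"
      show "openin ?T {u \<in> topspace ?T. ?\<Phi> u \<in> U}"
        unfolding openin_free_group_topology
      proof
        fix u assume "u \<in> {u \<in> topspace ?T. ?\<Phi> u \<in> U}"
        then have "openin T' {x. ?\<Phi> u + x \<in> U}" "0 \<in> {x. ?\<Phi> u + x \<in> U}"
          using openin_translation[OF tg U] by auto
        then obtain K where K: "openin T' K" "additive_subgroup K" "K \<subseteq> {x. ?\<Phi> u + x \<in> U}"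
          using T' unfolding NA_abelian_group_def by blast
        have "eventually (\<lambda>(x, y). \<phi> x - \<phi> y \<in> K) uniformity"
          using \<phi> K(1) additive_subgroupD(1)[OF K(2)] uniformly_continuous_into_iff[of T' \<phi>] ts by auto
        then have "eventually (\<lambda>(x, y). frag_of x - frag_of y \<in> ?\<Phi> -` K) uniformity"
          by (simp add: diff frag_extension_frag_of)
        moreover have "additive_subgroup (?\<Phi> -` K)"
          using additive_subgroupD[OF K(2)] by (auto simp: additive_subgroup_def zero add minus)
        ultimately have "?\<Phi> -` K \<in> free_subgroups" by (simp add: free_subgroups_def)
        then show "\<exists>H\<in>free_subgroups. \<forall>h\<in>H. u + h \<in> {u \<in> topspace ?T. ?\<Phi> u \<in> U}"
          using K(3) by (intro bexI[of _ "?\<Phi> -` K"]) (auto simp: add topspace_free_group_topology)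
      qed
    qed (simp add: ts)
    then show "Modules.additive ?\<Phi> \<and> continuous_map ?T T' ?\<Phi> \<and> (\<forall>x. ?\<Phi> (frag_of x) = \<phi> x)"
      by (simp add: additive_frag_extension frag_extension_frag_of)
    show "\<Psi> = ?\<Phi>" if "Modules.additive \<Psi> \<and> continuous_map ?T T' \<Psi> \<and> (\<forall>x. \<Psi> (frag_of x) = \<phi> x)" for \<Psi>
      using that by (intro additive_eq_on_frag_of additive_frag_extension) (simp_all add: frag_extension_frag_of)
  qed
  ultimately show ?thesis
    using NA_abelian_group_free_group_topology unfolding free_NA_abelian_group_for_def by blast
qed

theorem free_NA_abelian_group_iff: "free_NA_abelian_group T \<longleftrightarrow> T = free_group_topology"
proof
  assume T: "free_NA_abelian_group T"
  let ?T = "free_group_topology :: ('a \<Rightarrow>\<^sub>0 int) topology"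
  have free: "NA_abelian_group ?T" "uniformly_continuous_into ?T frag_of"
    using free_NA_abelian_group_topology[where ?'g = "'a \<Rightarrow>\<^sub>0 int"]
    unfolding free_NA_abelian_group_for_def by blast+
  have na: "NA_abelian_group T" and uc: "uniformly_continuous_into T frag_of"
    using T unfolding free_NA_abelian_group_def free_NA_abelian_group_for_def by blast+
  have tg: "topological_abelian_group T" and ts: "topspace T = UNIV"
    using na by (auto simp: NA_abelian_group_def topological_abelian_group_def)
  have 1: "openin ?T U" if U: "openin T U" for U
    unfolding openin_free_group_topology
  proof
    fix u assume "u \<in> U"
    then have "openin T {x. u + x \<in> U}" "0 \<in> {x. u + x \<in> U}"
      using openin_translation[OF tg U] by auto
    then obtain K where K: "openin T K" "additive_subgroup K" "K \<subseteq> {x. u + x \<in> U}"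
      using na unfolding NA_abelian_group_def by blast
    have "eventually (\<lambda>(x, y). frag_of x - frag_of y \<in> K) uniformity"
      using uc K(1) additive_subgroupD(1)[OF K(2)] uniformly_continuous_into_iff[of T frag_of] ts by auto
    then have "K \<in> free_subgroups" using K(2) by (simp add: free_subgroups_def)
    then show "\<exists>H\<in>free_subgroups. \<forall>h\<in>H. u + h \<in> U" using K(3) by blast
  qed
  obtain \<Phi> where \<Phi>: "Modules.additive \<Phi>" "continuous_map T ?T \<Phi>" "\<And>x. \<Phi> (frag_of x) = frag_of x"
  proof -
    have "\<forall>(T' :: ('a \<Rightarrow>\<^sub>0 int) topology) \<phi>.
        NA_abelian_group T' \<and> uniformly_continuous_into T' \<phi> \<longrightarrow>
        (\<exists>!\<Phi>. Modules.additive \<Phi> \<and> continuous_map T T' \<Phi> \<and> (\<forall>x. \<Phi> (frag_of x) = \<phi> x))"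
      using T unfolding free_NA_abelian_group_def free_NA_abelian_group_for_def by simp
    from this[rule_format, OF conjI[OF free]] show thesis using that by blast
  qed
  have "\<Phi> = id"
    by (rule additive_eq_on_frag_of[OF \<Phi>(1)]) (simp_all add: Modules.additive_def \<Phi>(3))
  with \<Phi>(2) have "openin T U" if "openin ?T U" for U
    using openin_continuous_map_preimage[OF _ that, of T id] by (simp add: ts)
  then show "T = ?T" using 1 unfolding topology_eq by blast
next
  assume "T = free_group_topology"
  then show "free_NA_abelian_group T"
    by (simp add: free_NA_abelian_group_def free_NA_abelian_group_topology)
qed

theorem free_NA_abelian_group_universal:
  assumes "free_NA_abelian_group T"
  shows "free_NA_abelian_group_for TYPE('g::ab_group_add) T"
  using assms free_NA_abelian_group_topology by (simp add: free_NA_abelian_group_iff)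


subsection \<open>The free abelian group inside the free vector space\<close>

lemma lookup_A_into_L: "Poly_Mapping.lookup (A_into_L u) x = of_int (Poly_Mapping.lookup u x)"
  by (simp add: A_into_L_def Poly_Mapping.map.rep_eq when_def)

lemma A_into_L_frag_of: "A_into_L (frag_of x) = vec_of x"
  by (rule poly_mapping_eqI) (simp add: lookup_A_into_L lookup_vec_of lookup_single when_def)

lemma additive_A_into_L: "Modules.additive A_into_L"
  by (intro Modules.additive.intro poly_mapping_eqI) (simp add: lookup_A_into_L lookup_add)

lemma inj_A_into_L: "inj (A_into_L :: ('b \<Rightarrow>\<^sub>0 int) \<Rightarrow> 'b \<Rightarrow>\<^sub>0 'a::field_char_0)"
proof (intro injI poly_mapping_eqI)
  fix u w :: "'b \<Rightarrow>\<^sub>0 int" and x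
  assume "A_into_L u = (A_into_L w :: 'b \<Rightarrow>\<^sub>0 'a)"
  then have "Poly_Mapping.lookup (A_into_L u :: 'b \<Rightarrow>\<^sub>0 'a) x = Poly_Mapping.lookup (A_into_L w) x" by simp
  then show "Poly_Mapping.lookup u x = Poly_Mapping.lookup w x" by (simp add: lookup_A_into_L)
qed

lemma range_A_into_L:
  "range A_into_L = (additive_subgroup hull range (vec_of :: 'x \<Rightarrow> 'x \<Rightarrow>\<^sub>0 'f::field_char_0))"
proof -
  interpret A: Modules.additive "A_into_L :: _ \<Rightarrow> 'x \<Rightarrow>\<^sub>0 'f" by (rule additive_A_into_L)
  show ?thesis
  proof (rule hull_unique[symmetric])
    show "range (vec_of :: 'x \<Rightarrow> 'x \<Rightarrow>\<^sub>0 'f) \<subseteq> range A_into_L"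
    proof
      fix w :: "'x \<Rightarrow>\<^sub>0 'f" assume "w \<in> range vec_of"
      then obtain x where "w = vec_of x" by blast
      then show "w \<in> range A_into_L" by (intro range_eqI[of _ _ "frag_of x"]) (simp add: A_into_L_frag_of)
    qed
    show "additive_subgroup (range (A_into_L :: _ \<Rightarrow> 'x \<Rightarrow>\<^sub>0 'f))"
      unfolding additive_subgroup_def
    proof (intro conjI ballI)
      show "0 \<in> range (A_into_L :: _ \<Rightarrow> 'x \<Rightarrow>\<^sub>0 'f)" by (rule range_eqI[of _ _ 0]) (simp add: A.zero)
    next
      fix x y :: "'x \<Rightarrow>\<^sub>0 'f" assume "x \<in> range A_into_L" "y \<in> range A_into_L"
      then obtain a b where "x = A_into_L a" "y = A_into_L b" by blast
      then show "x + y \<in> range A_into_L" by (intro range_eqI[of _ _ "a + b"]) (simp add: A.add)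
    next
      fix x :: "'x \<Rightarrow>\<^sub>0 'f" assume "x \<in> range A_into_L"
      then obtain a where "x = A_into_L a" by blast
      then show "- x \<in> range A_into_L" by (intro range_eqI[of _ _ "- a"]) (simp add: A.minus)
    qed
    fix H assume H: "range (vec_of :: 'x \<Rightarrow> 'x \<Rightarrow>\<^sub>0 'f) \<subseteq> H" "additive_subgroup H"
    have "A_into_L u \<in> H" for u
    proof -
      have "Poly_Mapping.keys u \<subseteq> UNIV" by simp
      then show ?thesis
      proof (induction u rule: frag_induction)
        case zero show ?case using additive_subgroupD(1)[OF H(2)] by (simp add: A.zero)
      next
        case (one x) show ?case using H(1) by (auto simp: A_into_L_frag_of)
      next
        case (diff a b) then show ?case using additive_subgroupD(4)[OF H(2)] by (simp add: A.diff)
      qed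
    qed
    then show "range A_into_L \<subseteq> H" by blast
  qed
qed

end

theory Submission
  imports Defs
begin

text \<open>Both topologies are known explicitly. If \<open>v n < 1\<close> for some integer \<open>n \<noteq> 0\<close>, then
  \<open>n ^ k x\<close> tends to 0 in \<open>L(X)\<close>, whereas in \<open>A(X)\<close> it stays outside the open subgroup of elements of
  degree 0. Conversely, an open subgroup \<open>H\<close> of \<open>A(X)\<close> contains all \<open>x - y\<close> with \<open>(x, y) \<in> R\<close> for some
  equivalence relation \<open>R\<close> in the uniformity. The sup norm of the coefficients on \<open>L(X/R)\<close> pulls back to a
  continuous seminorm \<open>p\<close> on \<open>L(X)\<close>. If \<open>v\<close> is trivial on the rationals, \<open>p u < 1\<close> for \<open>u\<close> in
  \<open>A(X)\<close> forces the image of \<open>u\<close> in \<open>A(X/R)\<close> to vanish, so that \<open>u \<in> H\<close>.\<close>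

section \<open>Valuations of integers\<close>

lemma NA_valuationD:
  assumes "NA_valuation v"
  shows "0 \<le> v x" "v x = 0 \<longleftrightarrow> x = 0" "v (x * y) = v x * v y" "v (x + y) \<le> max (v x) (v y)"
  using assms by (auto simp: NA_valuation_def)

text \<open>Repeated addition of 1 never exceeds \<open>v 1 = 1\<close>, by the ultrametric
  inequality; signs are harmless because \<open>v (-1) = 1\<close>.\<close>

lemma NA_valuation_of_int_le_1:
  assumes "NA_valuation v"
  shows "v (of_int n :: 'f::field) \<le> 1"
proof -
  note one = NA_valuation_one[OF assms]
  have nat: "v (of_nat m :: 'f) \<le> 1" for m
  proof (induction m)
    case 0
    have "v 0 = 0" using NA_valuationD(2)[OF assms] by simp
    then show ?case by simp
  next
    case (Suc m)
    then show ?case using NA_valuationD(4)[OF assms, of 1 "of_nat m"] one(1) by simp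
  qed
  show ?thesis
  proof (cases n)
    case (nonneg m) then show ?thesis using nat[of m] by simp
  next
    case (neg m)
    have "v (- 1 * of_nat (Suc m) :: 'f) = v (of_nat (Suc m))"
      unfolding NA_valuationD(3)[OF assms] one(2) by simp
    then show ?thesis using nat[of "Suc m"] neg by simp
  qed
qed

text \<open>Since integers have valuation at most 1, excluding values below 1 forces the value 1,
  and multiplicativity carries this over to quotients. The form with \<open>< 1\<close> suits both
  directions of the theorem: it yields powers tending to 0, or else kills small integer
  coefficients.\<close>

lemma trivial_on_rationals_iff:
  assumes "NA_valuation v"
  shows "trivial_on_rationals (v :: 'f::field_char_0 \<Rightarrow> real) \<longleftrightarrow>
    (\<forall>n::int. n \<noteq> 0 \<longrightarrow> \<not> v (of_int n) < 1)"
proof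
  assume triv: "trivial_on_rationals v"
  show "\<forall>n::int. n \<noteq> 0 \<longrightarrow> \<not> v (of_int n) < 1"
  proof (intro allI impI)
    fix n :: int assume "n \<noteq> 0"
    then have "v (of_rat (of_int n)) = 1"
      using triv unfolding trivial_on_rationals_def by (metis of_int_eq_0_iff)
    then show "\<not> v (of_int n) < 1" by simp
  qed
next
  assume "\<forall>n::int. n \<noteq> 0 \<longrightarrow> \<not> v (of_int n) < 1"
  then have int: "v (of_int n) = 1" if "n \<noteq> 0" for n
    using that NA_valuation_of_int_le_1[OF assms, of n] by (simp add: order_antisym not_less)
  show "trivial_on_rationals v"
    unfolding trivial_on_rationals_def
  proof (intro allI impI)
    fix q :: rat assume "q \<noteq> 0"
    obtain a b where q: "q = Rat.Fract a b" "b > 0" by (cases q) auto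
    with \<open>q \<noteq> 0\<close> have "a \<noteq> 0" by (auto simp: rat_number_collapse)
    have "(of_rat q :: 'f) * of_int b = of_int a" using q by (simp add: of_rat_rat)
    then have "v (of_rat q) * v (of_int b) = v (of_int a)"
      using NA_valuationD(3)[OF assms] by metis
    then show "v (of_rat q) = 1" using int[of a] int[of b] \<open>a \<noteq> 0\<close> q(2) by simp
  qed
qed

lemma NA_valuation_power:
  assumes "NA_valuation v"
  shows "v (a ^ k) = v a ^ k"
  by (induction k) (simp_all add: NA_valuation_one[OF assms] NA_valuationD(3)[OF assms])

section \<open>The seminorm of an equivalence relation\<close>

definition sup_norm :: "('f::field \<Rightarrow> real) \<Rightarrow> ('x \<Rightarrow>\<^sub>0 'f) \<Rightarrow> real" where
  \<comment> \<open>The inserted 0 keeps \<open>Max\<close> meaningful for the zero vector, which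
    has no keys.\<close>
  "sup_norm v u = Max (insert 0 ((\<lambda>x. v (Poly_Mapping.lookup u x)) ` Poly_Mapping.keys u))"

text \<open>Coefficients outside the support contribute \<open>v 0 = 0\<close>, so bounds can be
  checked at all points without mentioning supports.\<close>

lemma sup_norm_le_iff:
  assumes "NA_valuation v"
  shows "sup_norm v u \<le> c \<longleftrightarrow> 0 \<le> c \<and> (\<forall>x. v (Poly_Mapping.lookup u x) \<le> c)"
proof -
  have "v 0 = 0" using NA_valuationD(2)[OF assms] by simp
  then have "0 \<le> c \<Longrightarrow> x \<notin> Poly_Mapping.keys u \<Longrightarrow> v (Poly_Mapping.lookup u x) \<le> c" for x
    by (simp add: in_keys_iff)
  then show ?thesis
    unfolding sup_norm_def by auto
qed

lemma lookup_le_sup_norm: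
  assumes "NA_valuation v"
  shows "v (Poly_Mapping.lookup u x) \<le> sup_norm v u"
  using sup_norm_le_iff[OF assms, of u "sup_norm v u"] by simp

lemma ultra_seminorm_sup_norm:
  assumes "NA_valuation (v :: 'f::field \<Rightarrow> real)"
  shows "ultra_seminorm v vec_scale (sup_norm v :: ('x \<Rightarrow>\<^sub>0 'f) \<Rightarrow> real)"
  unfolding ultra_seminorm_def
proof (intro conjI allI)
  note D = NA_valuationD[OF assms] and le = sup_norm_le_iff[OF assms] and ge = lookup_le_sup_norm[OF assms]
  show nn: "0 \<le> sup_norm v u" for u :: "'x \<Rightarrow>\<^sub>0 'f" using le[of u "sup_norm v u"] by simp
  show "sup_norm v (0 :: 'x \<Rightarrow>\<^sub>0 'f) = 0" by (simp add: sup_norm_def)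
  show "sup_norm v (u + w) \<le> max (sup_norm v u) (sup_norm v w)" for u w :: "'x \<Rightarrow>\<^sub>0 'f"
    unfolding le
  proof (intro conjI allI)
    show "0 \<le> max (sup_norm v u) (sup_norm v w)" using nn[of u] by simp
    fix x
    show "v (Poly_Mapping.lookup (u + w) x) \<le> max (sup_norm v u) (sup_norm v w)"
      using D(4)[of "Poly_Mapping.lookup u x" "Poly_Mapping.lookup w x"] ge[of u x] ge[of w x]
      by (simp add: lookup_add)
  qed
  \<comment> \<open>Only this inequality is proved coefficientwise; applying it to
    \<open>inverse a\<close> gives the reverse one.\<close>
  have scale_le: "sup_norm v (vec_scale a u) \<le> v a * sup_norm v u" for a and u :: "'x \<Rightarrow>\<^sub>0 'f"
    unfolding le using D(1)[of a] nn[of u] ge[of u] by (simp add: D(3) mult_left_mono)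
  show "sup_norm v (vec_scale a u) = v a * sup_norm v u" for a and u :: "'x \<Rightarrow>\<^sub>0 'f"
  proof (cases "a = 0")
    case True
    then show ?thesis using scale_le[of a u] nn[of "vec_scale a u"] D(2)[of a] by simp
  next
    case False
    have "vec_scale (inverse a) (vec_scale a u) = u"
      using False by (intro poly_mapping_eqI) simp
    then have "v a * sup_norm v u \<le> v a * (v (inverse a) * sup_norm v (vec_scale a u))"
      using scale_le[of "inverse a" "vec_scale a u"] D(1)[of a] by (simp add: mult_left_mono)
    also have "\<dots> = v (a * inverse a) * sup_norm v (vec_scale a u)" by (simp only: D(3) mult.assoc)
    also have "\<dots> = sup_norm v (vec_scale a u)" using False NA_valuation_one(1)[OF assms] by simp
    finally show ?thesis using scale_le[of a u] by simp
  qed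
qed

text \<open>Replacing each point by a fixed representative of its class realises \<open>L(X/R)\<close> inside \<open>L(X)\<close>.\<close>

lemma equiv_representatives:
  assumes "equiv UNIV R"
  obtains rep where "\<And>x. (x, rep x) \<in> R" "\<And>x y. (x, y) \<in> R \<Longrightarrow> rep x = rep y"
proof
  fix x y
  have "(x, x) \<in> R" using assms by (simp add: equiv_def refl_on_def)
  then show "(x, SOME z. z \<in> R `` {x}) \<in> R" by (metis Image_singleton_iff someI)
  show "(SOME z. z \<in> R `` {x}) = (SOME z. z \<in> R `` {y})" if "(x, y) \<in> R"
    using equiv_class_eq[OF assms that] by simp
qed

text \<open>This makes the embedding open onto its image: every basic neighbourhood of 0 in
  \<open>A(X)\<close> contains the trace of a seminorm ball.\<close>

lemma free_subgroup_seminorm: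
  fixes v :: "'f::field_char_0 \<Rightarrow> real" and H :: "('x::uniform_space \<Rightarrow>\<^sub>0 int) set"
  assumes v: "NA_valuation v" and NA: "NA_uniformity (uniformity :: ('x \<times> 'x) filter)"
    and triv: "trivial_on_rationals v" and H: "H \<in> free_subgroups"
  obtains p where "p \<in> free_seminorms v" "\<And>u. p (A_into_L u) < 1 \<Longrightarrow> u \<in> H"
proof -
  have sub: "additive_subgroup H" using H by (simp add: free_subgroups_def)
  have "eventually (\<lambda>z. z \<in> {(x, y). frag_of x - frag_of y \<in> H}) uniformity"
    using H by (simp add: free_subgroups_def case_prod_unfold)
  then obtain R where R: "equiv UNIV R" "eventually (\<lambda>z. z \<in> R) uniformity"
      "R \<subseteq> {(x, y). frag_of x - frag_of y \<in> H}"
    using NA unfolding NA_uniformity_def by blast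
  obtain rep where rep: "\<And>x. (x, rep x) \<in> R" "\<And>x y. (x, y) \<in> R \<Longrightarrow> rep x = rep y"
    using equiv_representatives[OF R(1)] by metis
  define l :: "('x \<Rightarrow>\<^sub>0 'f) \<Rightarrow> 'x \<Rightarrow>\<^sub>0 'f" where "l = vec_extension vec_scale (\<lambda>x. vec_of (rep x))"
  \<comment> \<open>\<open>m\<close> is the integer counterpart of \<open>l\<close>: both move each
    point to its representative, so \<open>A_into_L\<close> intertwines them.\<close>
  define m :: "('x \<Rightarrow>\<^sub>0 int) \<Rightarrow> 'x \<Rightarrow>\<^sub>0 int" where "m = frag_extension (\<lambda>x. frag_of (rep x))"
  have lin: "Vector_Spaces.linear vec_scale vec_scale l"
    unfolding l_def by (rule linear_vec_extension[OF vector_space_vec_scale])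
  have l_of: "l (vec_of x) = vec_of (rep x)" for x
    unfolding l_def by (rule vec_extension_vec_of[OF vector_space_vec_scale])
  have m_of: "m (frag_of x) = frag_of (rep x)" for x
    unfolding m_def by (rule frag_extension_frag_of)
  interpret l: Vector_Spaces.linear vec_scale vec_scale l by (rule lin)
  interpret m: Modules.additive m unfolding m_def by (rule additive_frag_extension)
  interpret A: Modules.additive "A_into_L :: _ \<Rightarrow> 'x \<Rightarrow>\<^sub>0 'f" by (rule additive_A_into_L)
  have "(\<lambda>u. l (A_into_L u)) = (\<lambda>u. A_into_L (m u))"
    by (rule additive_eq_on_frag_of)
      (simp_all add: Modules.additive_def A.add l.add m.add A_into_L_frag_of l_of m_of)
  then have lA: "l (A_into_L u) = A_into_L (m u)" for u by (rule fun_cong)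
  let ?p = "\<lambda>u. sup_norm v (l u)"
  have norm_0: "sup_norm v (0 :: 'x \<Rightarrow>\<^sub>0 'f) = 0" by (rule ultra_seminormD(2)[OF ultra_seminorm_sup_norm[OF v]])
  have us: "ultra_seminorm v vec_scale ?p"
    by (rule ultra_seminorm_compose[OF ultra_seminorm_sup_norm[OF v] lin])
  have "eventually (\<lambda>(x, y). ?p (vec_of x - vec_of y) < r) uniformity" if "0 < r" for r
  proof (rule eventually_mono[OF R(2)])
    fix z assume "z \<in> R"
    then show "case z of (x, y) \<Rightarrow> ?p (vec_of x - vec_of y) < r"
      using that rep(2) by (cases z) (auto simp: l.diff l_of norm_0)
  qed
  then have "?p \<in> free_seminorms v" using us by (simp add: free_seminorms_def)
  moreover have "u \<in> H" if "?p (A_into_L u) < 1" for u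
  proof -
    \<comment> \<open>The coefficients of \<open>m u\<close> are integers of valuation below 1,
      hence 0.\<close>
    have "m u = 0"
    proof (rule poly_mapping_eqI)
      fix x
      have "v (of_int (Poly_Mapping.lookup (m u) x)) < 1"
        using lookup_le_sup_norm[OF v, of "A_into_L (m u)" x] that
        by (simp add: lA lookup_A_into_L)
      then show "Poly_Mapping.lookup (m u) x = Poly_Mapping.lookup 0 x"
        using triv unfolding trivial_on_rationals_iff[OF v] by auto
    qed
    moreover have "Poly_Mapping.keys u \<subseteq> UNIV" by simp
    \<comment> \<open>Each generator differs from its representative by an element of
      \<open>H\<close>, and this passes to differences.\<close>
    then have "u - m u \<in> H"
    proof (induction u rule: frag_induction)
      case zero
      show ?case using additive_subgroupD(1)[OF sub] by (simp add: m.zero)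
    next
      case (one x)
      show ?case using rep(1)[of x] R(3) by (auto simp: m_of)
    next
      case (diff a b)
      have "(a - b) - m (a - b) = (a - m a) - (b - m b)" by (simp add: m.diff)
      then show ?case using additive_subgroupD(4)[OF sub diff] by (simp only:)
    qed
    ultimately show ?thesis by simp
  qed
  ultimately show thesis by (rule that)
qed

section \<open>The embedding\<close>

text \<open>By the ultrametric inequality, a seminorm ball around 0 pulls back to a subgroup;
  uniform continuity of \<open>vec_of\<close> for that seminorm makes this subgroup open.\<close>

lemma continuous_A_into_L:
  fixes v :: "'f::field_char_0 \<Rightarrow> real"
  assumes v: "NA_valuation v"
  shows "continuous_map free_group_topology (seminorm_topology (free_seminorms v))
    (A_into_L :: ('x::uniform_space \<Rightarrow>\<^sub>0 int) \<Rightarrow> 'x \<Rightarrow>\<^sub>0 'f)"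
  unfolding continuous_map_seminorm_topology
proof (intro ballI allI impI)
  fix p :: "('x \<Rightarrow>\<^sub>0 'f) \<Rightarrow> real" and c :: "'x \<Rightarrow>\<^sub>0 'f" and r :: real
  assume p: "p \<in> free_seminorms v" and r: "0 < r"
  interpret A: Modules.additive "A_into_L :: _ \<Rightarrow> 'x \<Rightarrow>\<^sub>0 'f" by (rule additive_A_into_L)
  have us: "ultra_seminorm v vec_scale p" using p by (simp add: free_seminorms_def)
  note D = ultra_seminormD[OF us]
  let ?H = "{h. p (A_into_L h) < r}"
  have "additive_subgroup ?H"
    unfolding additive_subgroup_def
    using r D(2) ultra_seminorm_uminus[OF v vector_space_vec_scale us] le_less_trans[OF D(3)]
    by (auto simp: A.zero A.add A.minus)
  moreover have "eventually (\<lambda>(x, y). frag_of x - frag_of y \<in> ?H) uniformity"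
    using p r by (simp add: free_seminorms_def A.diff A_into_L_frag_of)
  ultimately have H: "?H \<in> free_subgroups" by (simp add: free_subgroups_def)
  show "openin free_group_topology
      {u \<in> topspace free_group_topology. p (A_into_L u - c) < r}"
    unfolding openin_free_group_topology topspace_free_group_topology
  proof (intro ballI bexI[OF _ H])
    fix u h :: "'x \<Rightarrow>\<^sub>0 int"
    assume "u \<in> {u \<in> UNIV. p (A_into_L u - c) < r}" "h \<in> ?H"
    then show "u + h \<in> {u \<in> UNIV. p (A_into_L u - c) < r}"
      using D(3)[of "A_into_L u - c" "A_into_L h"] by (simp add: A.add algebra_simps)
  qed
qed

lemma embedding_A_into_L:
  fixes v :: "'f::field_char_0 \<Rightarrow> real"
  assumes v: "NA_valuation v" and NA: "NA_uniformity (uniformity :: ('x::uniform_space \<times> 'x) filter)"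
    and triv: "trivial_on_rationals v"
  shows "embedding_map free_group_topology (seminorm_topology (free_seminorms v))
    (A_into_L :: ('x \<Rightarrow>\<^sub>0 int) \<Rightarrow> 'x \<Rightarrow>\<^sub>0 'f)"
proof -
  let ?A = "A_into_L :: ('x \<Rightarrow>\<^sub>0 int) \<Rightarrow> 'x \<Rightarrow>\<^sub>0 'f"
  let ?T = "seminorm_topology (free_seminorms v) :: ('x \<Rightarrow>\<^sub>0 'f) topology"
  let ?S = "subtopology ?T (range ?A)"
  interpret A: Modules.additive ?A by (rule additive_A_into_L)
  have "open_map free_group_topology ?S ?A"
    unfolding open_map_def
  proof (intro allI impI)
    fix U :: "('x \<Rightarrow>\<^sub>0 int) set"
    assume U: "openin free_group_topology U"
    show "openin ?S (?A ` U)"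
    proof (subst openin_subopen, intro ballI)
      fix w assume "w \<in> ?A ` U"
      then obtain u where u: "u \<in> U" "w = ?A u" by blast
      obtain H where H: "H \<in> free_subgroups" "\<forall>h\<in>H. u + h \<in> U"
        using U u(1) unfolding openin_free_group_topology by blast
      obtain p where p: "p \<in> free_seminorms v" "\<And>u. p (?A u) < 1 \<Longrightarrow> u \<in> H"
        using free_subgroup_seminorm[OF v NA triv H(1)] by metis
      \<comment> \<open>A point \<open>?A a\<close> of this ball satisfies
        \<open>p (?A (a - u)) < 1\<close>, so \<open>a - u\<close> lies in \<open>H\<close> and
        \<open>a\<close> in \<open>U\<close>.\<close>
      let ?B = "{y. p (y - w) < 1} \<inter> range ?A"
      have "openin ?S ?B"
        using openin_seminorm_ball[OF p(1), of 1 w] by (intro openin_subtopology_Int) simp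
      moreover have "p 0 = 0" using p(1) ultra_seminormD(2) by (auto simp: free_seminorms_def)
      then have "w \<in> ?B" using u(2) by simp
      moreover have "?B \<subseteq> ?A ` U"
      proof
        fix y assume "y \<in> ?B"
        then obtain a where a: "y = ?A a" "p (?A (a - u)) < 1" using u(2) by (auto simp: A.diff)
        then have "u + (a - u) \<in> U" using p(2) H(2) by blast
        then show "y \<in> ?A ` U" using a(1) by simp
      qed
      ultimately show "\<exists>B. openin ?S B \<and> w \<in> B \<and> B \<subseteq> ?A ` U" by blast
    qed
  qed
  then have "homeomorphic_map free_group_topology ?S ?A"
    using continuous_A_into_L[OF v]
    by (intro bijective_open_imp_homeomorphic_map)
      (auto simp: continuous_map_in_subtopology topspace_free_group_topology
        intro: inj_A_into_L)
  then show ?thesis by (simp add: embedding_map_def topspace_free_group_topology)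
qed

text \<open>Extending the constant 1 gives the sum of the coefficients, which vanishes on
  \<open>x - y\<close> for all pairs, hence on every entourage.\<close>

lemma degree_zero_free_subgroups:
  "{u. frag_extension (\<lambda>x. 1 :: int) u = 0} \<in> (free_subgroups :: ('x::uniform_space \<Rightarrow>\<^sub>0 int) set set)"
proof -
  interpret Modules.additive "frag_extension (\<lambda>x::'x. 1 :: int)" by (rule additive_frag_extension)
  show ?thesis
    by (auto simp: free_subgroups_def additive_subgroup_def zero add minus diff
        frag_extension_frag_of case_prod_unfold)
qed

lemma embedding_imp_trivial_on_rationals:
  fixes v :: "'f::field_char_0 \<Rightarrow> real"
  assumes v: "NA_valuation v"
    and emb: "embedding_map free_group_topology (seminorm_topology (free_seminorms v))
      (A_into_L :: ('x::uniform_space \<Rightarrow>\<^sub>0 int) \<Rightarrow> 'x \<Rightarrow>\<^sub>0 'f)"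
  shows "trivial_on_rationals v"
  unfolding trivial_on_rationals_iff[OF v]
proof (intro allI impI notI)
  fix n :: int assume n: "n \<noteq> 0" "v (of_int n) < 1"
  let ?A = "A_into_L :: ('x \<Rightarrow>\<^sub>0 int) \<Rightarrow> 'x \<Rightarrow>\<^sub>0 'f"
  let ?P = "free_seminorms v :: (('x \<Rightarrow>\<^sub>0 'f) \<Rightarrow> real) set"
  interpret A: Modules.additive ?A by (rule additive_A_into_L)
  define deg where "deg = frag_extension (\<lambda>x::'x. 1 :: int)"
  interpret deg: Modules.additive deg unfolding deg_def by (rule additive_frag_extension)
  have us: "ultra_seminorm v vec_scale p" if "p \<in> ?P" for p
    using that by (simp add: free_seminorms_def)
  have "openin free_group_topology {u. u - 0 \<in> {u. deg u = 0}}"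
    unfolding deg_def by (rule openin_free_coset[OF degree_zero_free_subgroups])
  moreover have "open_map free_group_topology (subtopology (seminorm_topology ?P) (range ?A)) ?A"
    using emb by (simp add: embedding_map_def topspace_free_group_topology homeomorphic_imp_open_map)
  ultimately have "openin (subtopology (seminorm_topology ?P) (range ?A)) (?A ` {u. deg u = 0})"
    by (simp add: open_map_def)
  \<comment> \<open>An embedding is open onto its image, so the degree-0 subgroup is the trace of an
    open set \<open>W\<close> of \<open>L(X)\<close>.\<close>
  then obtain W where W: "openin (seminorm_topology ?P) W" "?A ` {u. deg u = 0} = W \<inter> range ?A"
    unfolding openin_subtopology by blast
  have "?A 0 \<in> ?A ` {u. deg u = 0}" by (rule imageI) (simp add: deg.zero)
  then have "0 \<in> W" using W(2) by (simp add: A.zero)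
  have "\<forall>x\<in>W. \<exists>F r. finite F \<and> F \<subseteq> ?P \<and> 0 < r \<and> {y. \<forall>p\<in>F. p (y - x) < r} \<subseteq> W"
    using W(1) openin_seminorm_topology[OF us] by simp
  from bspec[OF this \<open>0 \<in> W\<close>]
  obtain F r where F: "finite F" "F \<subseteq> ?P" "(0::real) < r" "{y. \<forall>p\<in>F. p (y - 0) < r} \<subseteq> W"
    by (elim exE conjE)
  \<comment> \<open>Any point serves, as types are inhabited. Only finitely many seminorms bound the
    neighbourhood inside \<open>W\<close>, so one exponent \<open>k\<close> works for all of
    them.\<close>
  fix x :: 'x
  have "eventually (\<lambda>k. v (of_int n) ^ k * p (vec_of x) < r) sequentially" for p
  proof (rule order_tendstoD(2)[OF _ F(3)])
    have "(\<lambda>k. v (of_int n) ^ k) \<longlonglongrightarrow> 0"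
      using n(2) NA_valuationD(1)[OF v] by (intro LIMSEQ_power_zero) simp
    from tendsto_mult_left_zero[OF this]
    show "(\<lambda>k. v (of_int n) ^ k * p (vec_of x)) \<longlonglongrightarrow> 0" .
  qed
  then have "eventually (\<lambda>k. \<forall>p\<in>F. v (of_int n) ^ k * p (vec_of x) < r) sequentially"
    by (intro eventually_ball_finite[OF F(1)] ballI)
  then obtain k where k: "\<forall>p\<in>F. v (of_int n) ^ k * p (vec_of x) < r"
    using eventually_happens trivial_limit_sequentially by blast
  let ?u = "frag_cmul (n ^ k) (frag_of x)"
  have Au: "?A ?u = vec_scale (of_int n ^ k) (vec_of x)"
    by (rule poly_mapping_eqI) (simp add: lookup_A_into_L lookup_vec_of)
  have "?A ?u \<in> W"
    using k F(2,4) ultra_seminormD(4)[OF us] by (force simp: Au NA_valuation_power[OF v])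
  then have "?A ?u \<in> ?A ` {u. deg u = 0}" using W(2) by blast
  then have "deg ?u = 0" by (simp add: inj_image_mem_iff[OF inj_A_into_L])
  \<comment> \<open>With values in the integers, \<open>?u\<close> has degree \<open>n ^ k\<close>,
    which is nonzero although \<open>?u\<close> was forced into degree 0.\<close>
  have "int_multiple j (1::int) = j" for j by (simp add: int_multiple_def)
  moreover have "Poly_Mapping.keys ?u \<subseteq> {x}" by auto
  ultimately have "deg ?u = n ^ k"
    by (simp add: deg_def frag_extension_superset[of "{x}"])
  with \<open>deg ?u = 0\<close> show False using n(1) by simp
qed

theorem theorem6p13:
  fixes v :: "'f::field_char_0 \<Rightarrow> real"
    and T_A :: "('x::{uniform_space, t2_space} \<Rightarrow>\<^sub>0 int) topology"
    and T_L :: "('x \<Rightarrow>\<^sub>0 'f) topology"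
  assumes "NA_valuation v"
    and "NA_uniformity (uniformity :: ('x \<times> 'x) filter)"
    and "free_NA_abelian_group T_A"
    and "free_NA_locally_convex v T_L"
  shows "embedding_map T_A T_L (A_into_L :: ('x \<Rightarrow>\<^sub>0 int) \<Rightarrow> 'x \<Rightarrow>\<^sub>0 'f) \<longleftrightarrow> trivial_on_rationals v"
proof -
  \<comment> \<open>The universal properties determine both topologies, so the explicit ones can be
    substituted.\<close>
  have T_A: "T_A = free_group_topology" using assms(3) by (simp add: free_NA_abelian_group_iff)
  have T_L: "T_L = seminorm_topology (free_seminorms v)"
    using assms(4) free_NA_locally_convex_iff[OF assms(1,2)] by blast
  show ?thesis
    unfolding T_A T_L
    using embedding_imp_trivial_on_rationals[OF assms(1)] embedding_A_into_L[OF assms(1,2)] by blast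
qed

end
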